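(* Let $V$ be a complex vector space of dimension $n+1$, let $f\in S^dV$, let $E$ be a vector bundle on $\mathbb{P}(V)$, let $L=\mathcal{O}(d)$ and let $X=v_d(\mathbb{P}(V))\subset\mathbb{P}(S^dV)$ be the $d$-th Veronese variety. Let $A_f\colon H^0(E)\to H^0(E^*\otimes L)^*$ be the linear map associated to $f$. Set $Z'=\operatorname{baseloc}(\ker A_f)$ and let $\operatorname{length}(Z')=s$. Assume that $$\operatorname{rank}(f)=\frac{\operatorname{rank}(A_f)}{\operatorname{rank}(E)}.$$ Then for any minimal decomposition $f=\sum_{i=1}^r c_iv_i$ with $z_i=[v_i]\in X$, $c_i\in\mathbb{C}$ and $Z=\{z_1,\ldots,z_r\}$, we have $Z\subset Z'$. If $\operatorname{length}(Z')<\infty$, then the General Tensor Decomposition Algorithm produces all minimal Waring decompositions of $f$; in particular, if the solution is unique, we find the unique Waring decomposition of $f$.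
   Context: $\mathbb{P}(V)$ is the space of lines in $V$, so $H^0(\mathbb{P}(V),\mathcal{O}(d))=S^dV^*$ and $f\in S^dV=H^0(L)^*$. The points of $X$ are the classes $[\ell^d]$ with $\ell\in V$ nonzero; $X$ is identified with $\mathbb{P}(V)$. The rank of $f$ is the minimum number $r$ of summands in an expression $f=\sum_{i=1}^r c_i v_i$ with $[v_i]\in X$, $c_i\in\mathbb{C}$ (equivalently $f=\sum c_i\ell_i^d$, $\ell_i\in V$); such a minimal expression is a minimal (Waring) decomposition. Decompositions are considered up to reordering and rescaling. The map $A_f\colon H^0(E)\to H^0(E^*\otimes L)^*$ is induced by the natural contraction $H^0(E)\otimes H^0(E^*\otimes L)\to H^0(L)$, namely $A_f(s)(t)=f(\langle s,t\rangle)$ for $s\in H^0(E)$, $t\in H^0(E^*\otimes L)$. For a space of sections of $E$, its base locus $\operatorname{baseloc}$ is the common zero locus of all its sections. General Tensor Decomposition Algorithm. Input: $f\in S^dV$ and a vector bundle $E$ on $\mathbb{P}(V)$, to be chosen. (1) Construct $A_f$, with $L=\mathcal{O}(d)$. (2) Compute $\ker A_f$; if it is trivial, stop (the method fails). (3) Find the base locus $Z'$ of $\ker A_f$; if $Z'$ does not consist of a finite set of reduced points, stop (the method fails); otherwise write $Z'=\{[\ell_1],\ldots,[\ell_s]\}$ with $\ell_i\in V$. (4) Solve the linear system $f=\sum_{i=1}^s c_i\ell_i^d$ in the unknowns $c_i\in\mathbb{C}$. Output: if there is a unique solution to (4), this is the unique Waring decomposition of $f$; otherwise one possibly finds many minimal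 Waring decompositions of $f$.
   Formalization: If Z' is finite but non-reduced, or n=0 and f≠0, the algorithm stops by its own rules; so its success is stated only for n≥1 and reduced Z', while for every finite-length Z' the minimal decompositions are shown to be the solutions of system (4) with rank(f) terms. *)

theory Defs
  imports "HOL-Analysis.Analysis" "HOL-Library.Function_Algebras" "HOL-Library.Extended_Nat"
    "HOL-Library.Multiset" "HOL-Library.Numeral_Type"
begin

text \<open>
  Complex vector spaces are given by a type of class \<open>ab_group_add\<close> together with a scalar
  multiplication satisfying \<^const>\<open>vector_space\<close>; \<open>sm\<close> is the scalar multiplication
  of \<open>V\<close>, whose underlying type is \<open>'v\<close>.  Spaces of functions carry the pointwise
  structure.
\<close>

definition fun_scale :: "(complex \<Rightarrow> 'u \<Rightarrow> 'u) \<Rightarrow> complex \<Rightarrow> ('a \<Rightarrow> 'u) \<Rightarrow> 'a \<Rightarrow> 'u"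
  where "fun_scale sc a g = (\<lambda>x. sc a (g x))"

text \<open>Linear maps from a subspace \<open>S\<close> to a subspace \<open>T\<close>, extended by zero outside
  \<open>S\<close> so that they are determined by their values on \<open>S\<close>.\<close>

definition lin_maps ::
    "(complex \<Rightarrow> 'w \<Rightarrow> 'w) \<Rightarrow> 'w set \<Rightarrow> (complex \<Rightarrow> 'u \<Rightarrow> 'u) \<Rightarrow> 'u set
      \<Rightarrow> ('w::ab_group_add \<Rightarrow> 'u::ab_group_add) set"
  where "lin_maps sc S sc' T =
    {\<alpha>. (\<forall>w\<in>S. \<alpha> w \<in> T) \<and> (\<forall>w. w \<notin> S \<longrightarrow> \<alpha> w = 0)
       \<and> (\<forall>w\<in>S. \<forall>w'\<in>S. \<alpha> (w + w') = \<alpha> w + \<alpha> w')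
       \<and> (\<forall>a. \<forall>w\<in>S. \<alpha> (sc a w) = sc' a (\<alpha> w))}"

definition dual_space :: "(complex \<Rightarrow> 'w \<Rightarrow> 'w) \<Rightarrow> 'w set \<Rightarrow> ('w::ab_group_add \<Rightarrow> complex) set"
  where "dual_space sc S = lin_maps sc S (*) UNIV"


section \<open>Projective space and its structure sheaf\<close>

text \<open>\<open>\<P>(W)\<close> is the set of lines of \<open>W\<close>; \<open>line sc w\<close> is the class \<open>[w]\<close>.\<close>

definition line :: "(complex \<Rightarrow> 'w \<Rightarrow> 'w) \<Rightarrow> 'w \<Rightarrow> 'w::ab_group_add set"
  where "line sc w = module.span sc {w}"

definition proj_space :: "(complex \<Rightarrow> 'w \<Rightarrow> 'w) \<Rightarrow> 'w set \<Rightarrow> 'w::ab_group_add set set"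
  where "proj_space sc W = {line sc w | w. w \<in> W \<and> w \<noteq> 0}"

text \<open>\<open>S\<^sup>kV\<^sup>*\<close> as the homogeneous polynomial functions of degree \<open>k\<close> on \<open>V\<close>: sums of
  products of \<open>k\<close> linear forms.\<close>

definition hom_poly :: "(complex \<Rightarrow> 'v \<Rightarrow> 'v) \<Rightarrow> nat \<Rightarrow> ('v::ab_group_add \<Rightarrow> complex) set"
  where "hom_poly sm k =
    {p. \<exists>N (a :: nat \<Rightarrow> complex) \<xi>.
          (\<forall>j<N. \<forall>i<k. Vector_Spaces.linear sm (*) (\<xi> j i))
        \<and> p = (\<lambda>v. \<Sum>j<N. a j * (\<Prod>i<k. \<xi> j i v))}"

definition zariski_open :: "(complex \<Rightarrow> 'v \<Rightarrow> 'v) \<Rightarrow> 'v::ab_group_add set set \<Rightarrow> bool"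
  where "zariski_open sm U \<longleftrightarrow>
    (\<exists>T \<subseteq> (\<Union>k. hom_poly sm k). U = {line sm v | v. v \<noteq> 0 \<and> (\<exists>p\<in>T. p v \<noteq> 0)})"

text \<open>Regular functions on an open set: locally quotients of homogeneous polynomials of
  equal degree.\<close>

definition regular_on ::
    "(complex \<Rightarrow> 'v \<Rightarrow> 'v) \<Rightarrow> 'v::ab_group_add set set \<Rightarrow> ('v set \<Rightarrow> complex) \<Rightarrow> bool"
  where "regular_on sm U g \<longleftrightarrow>
    (\<forall>x\<in>U. \<exists>W k p q. zariski_open sm W \<and> x \<in> W \<and> W \<subseteq> U
        \<and> p \<in> hom_poly sm k \<and> q \<in> hom_poly sm k
        \<and> (\<forall>v. v \<noteq> 0 \<and> line sm v \<in> W \<longrightarrow> q v \<noteq> 0 \<and> g (line sm v) = p v / q v))"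


section \<open>Vector bundles on \<open>\<P>(V)\<close>\<close>

text \<open>
  The fibres are subspaces of one vector space of type \<open>'w\<close>, which only serves to name the
  elements of the fibres: different fibres need not be related in it.  A chart
  \<open>(U, \<phi>)\<close> is a trivialisation over \<open>U\<close>, \<open>\<phi> x\<close> being the induced isomorphism from the fibre
  at \<open>x\<close> to \<open>\<complex>\<^sup>e\<close>, where \<open>e = CARD('e) \<ge> 1\<close> is the rank.
\<close>

record ('v, 'w, 'e) vbundle =
  bscale :: "complex \<Rightarrow> 'w \<Rightarrow> 'w"
  fibre :: "'v set \<Rightarrow> 'w set"
  charts :: "('v set set \<times> ('v set \<Rightarrow> 'w \<Rightarrow> complex ^ 'e)) set"

definition vector_bundle ::
    "(complex \<Rightarrow> 'v \<Rightarrow> 'v) \<Rightarrow> ('v::ab_group_add, 'w::ab_group_add, 'e::finite) vbundle \<Rightarrow> bool"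
  where "vector_bundle sm E \<longleftrightarrow>
      vector_space (bscale E)
    \<and> (\<forall>x\<in>proj_space sm UNIV. module.subspace (bscale E) (fibre E x))
    \<and> (\<forall>(U, \<phi>)\<in>charts E. zariski_open sm U
         \<and> (\<forall>x\<in>U. bij_betw (\<phi> x) (fibre E x) UNIV
              \<and> (\<forall>w\<in>fibre E x. \<forall>w'\<in>fibre E x. \<phi> x (w + w') = \<phi> x w + \<phi> x w')
              \<and> (\<forall>a. \<forall>w\<in>fibre E x. \<phi> x (bscale E a w) = a *s \<phi> x w)))
    \<and> (\<Union>(U, \<phi>)\<in>charts E. U) = proj_space sm UNIV
    \<and> (\<forall>(U, \<phi>)\<in>charts E. \<forall>(U', \<psi>)\<in>charts E. \<forall>k l.
         regular_on sm (U \<inter> U') (\<lambda>x. \<psi> x (inv_into (fibre E x) (\<phi> x) (axis l 1)) $ k))"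

definition bundle_rank :: "('v, 'w, 'e::finite) vbundle \<Rightarrow> nat"
  where "bundle_rank E = CARD('e)"

text \<open>\<open>H\<^sup>0(E)\<close>; sections are extended by zero outside \<open>\<P>(V)\<close>.\<close>

definition H0 ::
    "(complex \<Rightarrow> 'v \<Rightarrow> 'v) \<Rightarrow> ('v::ab_group_add, 'w::ab_group_add, 'e::finite) vbundle
      \<Rightarrow> ('v set \<Rightarrow> 'w) set"
  where "H0 sm E =
    {s. (\<forall>x\<in>proj_space sm UNIV. s x \<in> fibre E x) \<and> (\<forall>x. x \<notin> proj_space sm UNIV \<longrightarrow> s x = 0)
      \<and> (\<forall>(U, \<phi>)\<in>charts E. \<forall>k. regular_on sm U (\<lambda>x. \<phi> x (s x) $ k))}"

text \<open>
  The fibre of \<open>\<O>(d)\<close> at the line \<open>x\<close> is \<open>(x\<^sup>*)\<^bsup>\<otimes>d\<^esup>\<close>, that is, the space of functions on \<open>x\<close>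
  which are homogeneous of degree \<open>d\<close>.  Each linear form \<open>\<xi>\<close> gives the trivialisation
  \<open>h \<mapsto> h / \<xi>\<^sup>d\<close> over the open set where \<open>\<xi> \<noteq> 0\<close>.
\<close>

definition O_bundle ::
    "(complex \<Rightarrow> 'v \<Rightarrow> 'v) \<Rightarrow> nat \<Rightarrow> ('v::ab_group_add, 'v \<Rightarrow> complex, 1) vbundle"
  where "O_bundle sm d =
    \<lparr> bscale = fun_scale (*),
      fibre = (\<lambda>x. {h. (\<forall>v. v \<notin> x \<longrightarrow> h v = 0) \<and> (\<forall>a. \<forall>v\<in>x. h (sm a v) = a ^ d * h v)}),
      charts = {({line sm v | v. \<xi> v \<noteq> 0}, \<lambda>x h. \<chi> _. h (THE v. v \<in> x \<and> \<xi> v = 1)) | \<xi>.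
                  Vector_Spaces.linear sm (*) \<xi>} \<rparr>"

text \<open>The bundle \<open>Hom(E, F) = E\<^sup>* \<otimes> F\<close>, whose fibre at \<open>x\<close> consists of the linear maps from
  the fibre of \<open>E\<close> to the fibre of \<open>F\<close>; its charts send a linear map to its matrix.\<close>

definition hom_bundle ::
    "('v, 'w::ab_group_add, 'e::finite) vbundle \<Rightarrow> ('v, 'u::ab_group_add, 'f::finite) vbundle
      \<Rightarrow> ('v, 'w \<Rightarrow> 'u, 'f \<times> 'e) vbundle"
  where "hom_bundle E F =
    \<lparr> bscale = fun_scale (bscale F),
      fibre = (\<lambda>x. lin_maps (bscale E) (fibre E x) (bscale F) (fibre F x)),
      charts = {(U \<inter> U', \<lambda>x \<alpha>. \<chi> kl.
                    \<psi> x (\<alpha> (inv_into (fibre E x) (\<phi> x) (axis (snd kl) 1))) $ fst kl) | U \<phi> U' \<psi>.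
                  (U, \<phi>) \<in> charts E \<and> (U', \<psi>) \<in> charts F} \<rparr>"

text \<open>\<open>\<langle>s, t\<rangle>\<close> for sections \<open>s\<close> of \<open>E\<close> and \<open>t\<close> of \<open>E\<^sup>* \<otimes> L = Hom(E, L)\<close>.\<close>

definition contraction :: "('v set \<Rightarrow> 'w) \<Rightarrow> ('v set \<Rightarrow> 'w \<Rightarrow> 'u) \<Rightarrow> 'v set \<Rightarrow> 'u"
  where "contraction s t = (\<lambda>x. t x (s x))"


section \<open>Symmetric tensors, Veronese variety and Waring decompositions\<close>

type_synonym 'v sym_tensor = "('v set \<Rightarrow> 'v \<Rightarrow> complex) \<Rightarrow> complex"

abbreviation tscale :: "complex \<Rightarrow> 'v sym_tensor \<Rightarrow> 'v sym_tensor"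
  where "tscale \<equiv> fun_scale (*)"

text \<open>\<open>S\<^sup>dV = H\<^sup>0(\<O>(d))\<^sup>*\<close>.\<close>

definition sym_power :: "(complex \<Rightarrow> 'v \<Rightarrow> 'v) \<Rightarrow> nat \<Rightarrow> 'v::ab_group_add sym_tensor set"
  where "sym_power sm d =
    dual_space (fun_scale (bscale (O_bundle sm d))) (H0 sm (O_bundle sm d))"

text \<open>\<open>\<l>\<^sup>d \<in> S\<^sup>dV\<close> is evaluation at \<open>\<l>\<close> of homogeneous forms of degree \<open>d\<close>; the value of a
  section \<open>h\<close> at \<open>[\<l>]\<close> is a homogeneous function on the line \<open>[\<l>]\<close>, which is evaluated at
  \<open>\<l>\<close>.\<close>

definition pow :: "(complex \<Rightarrow> 'v \<Rightarrow> 'v) \<Rightarrow> nat \<Rightarrow> 'v::ab_group_add \<Rightarrow> 'v sym_tensor"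
  where "pow sm d l = (\<lambda>h. if h \<in> H0 sm (O_bundle sm d) then h (line sm l) l else 0)"

text \<open>The embedding \<open>v\<^sub>d : [\<l>] \<mapsto> [\<l>\<^sup>d]\<close> of \<open>\<P>(V)\<close> into \<open>\<P>(S\<^sup>dV)\<close>.\<close>

definition veronese ::
    "(complex \<Rightarrow> 'v \<Rightarrow> 'v) \<Rightarrow> nat \<Rightarrow> 'v::ab_group_add set \<Rightarrow> 'v sym_tensor set"
  where "veronese sm d x = module.span tscale (pow sm d ` x)"

definition veronese_variety ::
    "(complex \<Rightarrow> 'v \<Rightarrow> 'v) \<Rightarrow> nat \<Rightarrow> 'v::ab_group_add sym_tensor set set"
  where "veronese_variety sm d = veronese sm d ` proj_space sm UNIV"

text \<open>\<open>f = \<Sum>\<^bsub>i<r\<^esub> c\<^sub>i v\<^sub>i\<close> with \<open>[v\<^sub>i] \<in> X\<close>.\<close>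

definition waring_decomp ::
    "(complex \<Rightarrow> 'v \<Rightarrow> 'v) \<Rightarrow> nat \<Rightarrow> 'v::ab_group_add sym_tensor
      \<Rightarrow> nat \<Rightarrow> (nat \<Rightarrow> complex) \<Rightarrow> (nat \<Rightarrow> 'v sym_tensor) \<Rightarrow> bool"
  where "waring_decomp sm d f r c v \<longleftrightarrow>
      (\<forall>i<r. v i \<in> sym_power sm d \<and> v i \<noteq> 0 \<and> line tscale (v i) \<in> veronese_variety sm d)
    \<and> f = (\<Sum>i<r. tscale (c i) (v i))"

definition waring_rank ::
    "(complex \<Rightarrow> 'v \<Rightarrow> 'v) \<Rightarrow> nat \<Rightarrow> 'v::ab_group_add sym_tensor \<Rightarrow> nat"
  where "waring_rank sm d f = (LEAST r. \<exists>c v. waring_decomp sm d f r c v)"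

text \<open>The multiset of the terms \<open>c\<^sub>i v\<^sub>i\<close> is the decomposition up to reordering and up to
  rescaling \<open>(c\<^sub>i, v\<^sub>i)\<close> to \<open>(a\<^bsup>-1\<^esup> c\<^sub>i, a v\<^sub>i)\<close>.\<close>

definition minimal_waring_decomps ::
    "(complex \<Rightarrow> 'v \<Rightarrow> 'v) \<Rightarrow> nat \<Rightarrow> 'v::ab_group_add sym_tensor \<Rightarrow> 'v sym_tensor multiset set"
  where "minimal_waring_decomps sm d f =
    {image_mset (\<lambda>i. tscale (c i) (v i)) (mset_set {..<waring_rank sm d f}) | c v.
       waring_decomp sm d f (waring_rank sm d f) c v}"


section \<open>The map \<open>A\<^sub>f\<close>\<close>

definition A_map ::
    "(complex \<Rightarrow> 'v \<Rightarrow> 'v) \<Rightarrow> nat \<Rightarrow> 'v::ab_group_add sym_tensor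
      \<Rightarrow> ('v, 'w::ab_group_add, 'e::finite) vbundle
      \<Rightarrow> ('v set \<Rightarrow> 'w) \<Rightarrow> ('v set \<Rightarrow> 'w \<Rightarrow> 'v \<Rightarrow> complex) \<Rightarrow> complex"
  where "A_map sm d f E s =
    (\<lambda>t. if t \<in> H0 sm (hom_bundle E (O_bundle sm d)) then f (contraction s t) else 0)"

definition A_rank ::
    "(complex \<Rightarrow> 'v \<Rightarrow> 'v) \<Rightarrow> nat \<Rightarrow> 'v::ab_group_add sym_tensor
      \<Rightarrow> ('v, 'w::ab_group_add, 'e::finite) vbundle \<Rightarrow> nat"
  where "A_rank sm d f E = vector_space.dim (fun_scale (*)) (A_map sm d f E ` H0 sm E)"

definition A_ker ::
    "(complex \<Rightarrow> 'v \<Rightarrow> 'v) \<Rightarrow> nat \<Rightarrow> 'v::ab_group_add sym_tensor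
      \<Rightarrow> ('v, 'w::ab_group_add, 'e::finite) vbundle \<Rightarrow> ('v set \<Rightarrow> 'w) set"
  where "A_ker sm d f E = {s \<in> H0 sm E. A_map sm d f E s = 0}"


section \<open>Base loci as schemes\<close>

definition baseloc ::
    "(complex \<Rightarrow> 'v \<Rightarrow> 'v) \<Rightarrow> ('v::ab_group_add set \<Rightarrow> 'w::ab_group_add) set \<Rightarrow> 'v set set"
  where "baseloc sm K = {x \<in> proj_space sm UNIV. \<forall>s\<in>K. s x = 0}"

text \<open>Functions regular near \<open>x\<close>; their germs form the local ring at \<open>x\<close>.\<close>

definition local_ring ::
    "(complex \<Rightarrow> 'v \<Rightarrow> 'v) \<Rightarrow> 'v::ab_group_add set \<Rightarrow> ('v set \<Rightarrow> complex) set"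
  where "local_ring sm x = {g. \<exists>W. zariski_open sm W \<and> x \<in> W \<and> regular_on sm W g}"

text \<open>The ideal of the base scheme of \<open>K\<close> at \<open>x\<close>, generated by the coordinates of the sections
  in \<open>K\<close> with respect to a trivialisation around \<open>x\<close>.\<close>

definition base_ideal ::
    "(complex \<Rightarrow> 'v \<Rightarrow> 'v) \<Rightarrow> ('v::ab_group_add, 'w::ab_group_add, 'e::finite) vbundle
      \<Rightarrow> ('v set \<Rightarrow> 'w) set \<Rightarrow> 'v set \<Rightarrow> ('v set \<Rightarrow> complex) set"
  where "base_ideal sm E K x =
    {g \<in> local_ring sm x. \<exists>U \<phi> N a s k W. (U, \<phi>) \<in> charts E \<and> zariski_open sm W \<and> x \<in> W \<and> W \<subseteq> U
       \<and> (\<forall>j<(N::nat). a j \<in> local_ring sm x \<and> s j \<in> K)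
       \<and> (\<forall>y\<in>W. g y = (\<Sum>j<N. a j y * \<phi> y (s j y) $ k j))}"

text \<open>The complex dimension of the local ring of the base scheme at \<open>x\<close>, as the least size
  of a spanning family (and \<open>\<infinity>\<close> if there is no finite one).\<close>

definition base_mult ::
    "(complex \<Rightarrow> 'v \<Rightarrow> 'v) \<Rightarrow> ('v::ab_group_add, 'w::ab_group_add, 'e::finite) vbundle
      \<Rightarrow> ('v set \<Rightarrow> 'w) set \<Rightarrow> 'v set \<Rightarrow> enat"
  where "base_mult sm E K x =
    Inf {enat m | m. \<exists>b. (\<forall>i<m. b i \<in> local_ring sm x)
           \<and> (\<forall>g\<in>local_ring sm x. \<exists>c. (\<lambda>y. g y - (\<Sum>i<m. c i * b i y)) \<in> base_ideal sm E K x)}"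

definition baseloc_length ::
    "(complex \<Rightarrow> 'v \<Rightarrow> 'v) \<Rightarrow> ('v::ab_group_add, 'w::ab_group_add, 'e::finite) vbundle
      \<Rightarrow> ('v set \<Rightarrow> 'w) set \<Rightarrow> enat"
  where "baseloc_length sm E K =
    (if finite (baseloc sm K) then \<Sum>x\<in>baseloc sm K. base_mult sm E K x else \<infinity>)"

text \<open>The base scheme is a finite set of reduced points: its local ideals are radical.\<close>

definition finite_reduced ::
    "(complex \<Rightarrow> 'v \<Rightarrow> 'v) \<Rightarrow> ('v::ab_group_add, 'w::ab_group_add, 'e::finite) vbundle
      \<Rightarrow> ('v set \<Rightarrow> 'w) set \<Rightarrow> bool"
  where "finite_reduced sm E K \<longleftrightarrow>
      finite (baseloc sm K)
    \<and> (\<forall>x\<in>baseloc sm K. \<forall>g\<in>local_ring sm x. \<forall>k::nat.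
         (\<lambda>y. g y ^ k) \<in> base_ideal sm E K x \<longrightarrow> g \<in> base_ideal sm E K x)"


section \<open>The General Tensor Decomposition Algorithm\<close>

text \<open>A list of representatives \<open>\<l>\<^sub>1, \<dots>, \<l>\<^sub>s\<close> of the points of a finite set of points.\<close>

definition representatives ::
    "(complex \<Rightarrow> 'v \<Rightarrow> 'v) \<Rightarrow> 'v::ab_group_add set set \<Rightarrow> 'v list \<Rightarrow> bool"
  where "representatives sm Z ls \<longleftrightarrow>
    0 \<notin> set ls \<and> distinct (map (line sm) ls) \<and> set (map (line sm) ls) = Z"

text \<open>The solutions of \<open>f = \<Sum>\<^sub>i c\<^sub>i \<l>\<^sub>i\<^sup>d\<close> in \<open>\<complex>\<^sup>s\<close>, encoded as sequences vanishing from index \<open>s\<close> on.\<close>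

definition linear_system ::
    "(complex \<Rightarrow> 'v \<Rightarrow> 'v) \<Rightarrow> nat \<Rightarrow> 'v::ab_group_add sym_tensor \<Rightarrow> 'v list \<Rightarrow> (nat \<Rightarrow> complex) set"
  where "linear_system sm d f ls =
    {c. (\<forall>i\<ge>length ls. c i = 0) \<and> f = (\<Sum>i<length ls. tscale (c i) (pow sm d (ls ! i)))}"

text \<open>The decomposition belonging to a solution, again as the multiset of its (nonzero) terms.\<close>

definition solution_decomp ::
    "(complex \<Rightarrow> 'v \<Rightarrow> 'v) \<Rightarrow> nat \<Rightarrow> 'v::ab_group_add list \<Rightarrow> (nat \<Rightarrow> complex)
      \<Rightarrow> 'v sym_tensor multiset"
  where "solution_decomp sm d ls c =
    image_mset (\<lambda>i. tscale (c i) (pow sm d (ls ! i))) (mset_set {i. i < length ls \<and> c i \<noteq> 0})"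

text \<open>The algorithm, with \<open>ls\<close> the representatives chosen in step (3); \<open>None\<close> means that it
  stops without result, otherwise it returns the decompositions found in step (4).\<close>

definition gtd_algorithm ::
    "(complex \<Rightarrow> 'v \<Rightarrow> 'v) \<Rightarrow> nat \<Rightarrow> 'v::ab_group_add sym_tensor
      \<Rightarrow> ('v, 'w::ab_group_add, 'e::finite) vbundle \<Rightarrow> 'v list \<Rightarrow> 'v sym_tensor multiset set option"
  where "gtd_algorithm sm d f E ls =
    (let K = A_ker sm d f E in
     if K = {0} then None
     else if \<not> finite_reduced sm E K then None
     else Some (solution_decomp sm d ls ` linear_system sm d f ls))"

end

theory Submission
  imports Defs
begin

text \<open>
  If \<open>f = \<Sum>\<^sub>i b\<^sub>i \<l>\<^sub>i\<^sup>d\<close> has \<open>r\<close> terms, then \<open>A\<^sub>f(s)(t) = \<Sum>\<^sub>i b\<^sub>i \<langle>s, t\<rangle>(\<l>\<^sub>i)\<close>, so in terms of charts around the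
  points \<open>[\<l>\<^sub>i]\<close> the functional \<open>A\<^sub>f(s)\<close> is the combination of \<open>r \<cdot> rank(E)\<close> fixed functionals whose
  coefficients are the coordinates of the values \<open>s([\<l>\<^sub>i])\<close>.  If \<open>A\<^sub>f\<close> has rank \<open>r \<cdot> rank(E)\<close>, these
  functionals are linearly independent, so \<open>A\<^sub>f(s) = 0\<close> forces \<open>s([\<l>\<^sub>i]) = 0\<close> for all \<open>i\<close>.  Hence minimal
  decompositions are supported on the base locus, and they are exactly the solutions of the linear
  system with the least number of nonzero coefficients.
\<close>

section \<open>Function spaces and values of linear forms\<close>

lemma vector_space_complex: "vector_space ((*) :: complex \<Rightarrow> complex \<Rightarrow> complex)"
  by unfold_locales (auto simp: algebra_simps)

lemma vector_space_fun_scale: "vector_space (fun_scale (*) :: complex \<Rightarrow> ('a \<Rightarrow> complex) \<Rightarrow> 'a \<Rightarrow> complex)"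
  by unfold_locales (auto simp: algebra_simps fun_scale_def plus_fun_def)

lemma sum_apply: "(\<Sum>i\<in>I. F i) x = (\<Sum>i\<in>I. F i x)"
  for F :: "'i \<Rightarrow> 'a \<Rightarrow> 'b::comm_monoid_add"
  by (induction I rule: infinite_finite_induct) auto

lemma linear_mult: "Vector_Spaces.linear sm (*) \<xi> \<Longrightarrow> \<xi> (sm a v) = a * \<xi> v"
  by (metis linear_iff_module_hom module_hom.scale)

lemma linear_add: "Vector_Spaces.linear sm (*) \<xi> \<Longrightarrow> \<xi> (v + w) = \<xi> v + \<xi> w"
  by (metis linear_iff_module_hom module_hom.add)

lemma linear_zero: "Vector_Spaces.linear sm (*) \<xi> \<Longrightarrow> \<xi> 0 = (0::complex)"
  by (metis add_cancel_right_left linear_add add_0)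

section \<open>Homogeneous polynomials\<close>

lemma hom_poly_monomial:
  assumes "\<And>i. i < k \<Longrightarrow> Vector_Spaces.linear sm (*) (\<xi> i)"
  shows "(\<lambda>v. a * (\<Prod>i<k. \<xi> i v)) \<in> hom_poly sm k"
  unfolding hom_poly_def mem_Collect_eq
  by (rule exI[of _ 1], rule exI[of _ "\<lambda>_. a"], rule exI[of _ "\<lambda>_. \<xi>"]) (use assms in auto)

lemma hom_poly_zero: "(\<lambda>v. 0) \<in> hom_poly sm k"
  unfolding hom_poly_def mem_Collect_eq by (rule exI[of _ 0]) auto

lemma hom_poly_add:
  assumes "p \<in> hom_poly sm k" "q \<in> hom_poly sm k"
  shows "(\<lambda>v. p v + q v) \<in> hom_poly sm k"
proof -
  obtain N a \<xi> where p: "\<And>j i. j < N \<Longrightarrow> i < k \<Longrightarrow> Vector_Spaces.linear sm (*) (\<xi> j i)"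
    "p = (\<lambda>v. \<Sum>j<(N::nat). a j * (\<Prod>i<k. \<xi> j i v))"
    using assms(1) unfolding hom_poly_def by blast
  obtain M b \<eta> where q: "\<And>j i. j < M \<Longrightarrow> i < k \<Longrightarrow> Vector_Spaces.linear sm (*) (\<eta> j i)"
    "q = (\<lambda>v. \<Sum>j<(M::nat). b j * (\<Prod>i<k. \<eta> j i v))"
    using assms(2) unfolding hom_poly_def by blast
  \<comment> \<open>The two families of monomials are concatenated: indices below \<open>N\<close>
    come from \<open>p\<close>, and the others, shifted by \<open>N\<close>, from
    \<open>q\<close>.\<close>
  define c where "c = (\<lambda>j. if j < N then a j else b (j - N))"
  define \<zeta> where "\<zeta> = (\<lambda>j. if j < N then \<xi> j else \<eta> (j - N))"
  have "p v + q v = (\<Sum>j<N + M. c j * (\<Prod>i<k. \<zeta> j i v))" for v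
  proof -
    have "(\<Sum>j<N + M. c j * (\<Prod>i<k. \<zeta> j i v))
        = (\<Sum>j<N. c j * (\<Prod>i<k. \<zeta> j i v)) + (\<Sum>j=N..<N + M. c j * (\<Prod>i<k. \<zeta> j i v))"
      by (simp add: sum.atLeastLessThan_concat flip: atLeast0LessThan)
    also have "(\<Sum>j=N..<N + M. c j * (\<Prod>i<k. \<zeta> j i v)) = q v"
      using sum.shift_bounds_nat_ivl[of "\<lambda>j. c j * (\<Prod>i<k. \<zeta> j i v)" 0 N M]
      by (simp add: q c_def \<zeta>_def add.commute atLeast0LessThan)
    also have "(\<Sum>j<N. c j * (\<Prod>i<k. \<zeta> j i v)) = p v"
      by (simp add: p c_def \<zeta>_def)
    finally show ?thesis by simp
  qed
  moreover have "\<forall>j<N + M. \<forall>i<k. Vector_Spaces.linear sm (*) (\<zeta> j i)"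
    using p(1) q(1) by (auto simp: \<zeta>_def)
  ultimately show ?thesis
    unfolding hom_poly_def by blast
qed

lemma hom_poly_sum:
  assumes "\<And>j. j \<in> J \<Longrightarrow> p j \<in> hom_poly sm k"
  shows "(\<lambda>v. \<Sum>j\<in>J. p j v) \<in> hom_poly sm k"
  using assms
  by (induction J rule: infinite_finite_induct) (auto intro: hom_poly_zero hom_poly_add)

lemma hom_poly_mult:
  assumes "p \<in> hom_poly sm k" "q \<in> hom_poly sm l"
  shows "(\<lambda>v. p v * q v) \<in> hom_poly sm (k + l)"
proof -
  obtain N a \<xi> where p: "\<And>j i. j < N \<Longrightarrow> i < k \<Longrightarrow> Vector_Spaces.linear sm (*) (\<xi> j i)"
    "p = (\<lambda>v. \<Sum>j<(N::nat). a j * (\<Prod>i<k. \<xi> j i v))"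
    using assms(1) unfolding hom_poly_def by blast
  obtain M b \<eta> where q: "\<And>j i. j < M \<Longrightarrow> i < l \<Longrightarrow> Vector_Spaces.linear sm (*) (\<eta> j i)"
    "q = (\<lambda>v. \<Sum>j<(M::nat). b j * (\<Prod>i<l. \<eta> j i v))"
    using assms(2) unfolding hom_poly_def by blast
  \<comment> \<open>The product of the \<open>j\<close>-th monomial of \<open>p\<close> and the
    \<open>m\<close>-th of \<open>q\<close>: its first \<open>k\<close> factors are those of
    \<open>p\<close>, the remaining \<open>l\<close> those of \<open>q\<close>.\<close>
  define \<zeta> where "\<zeta> = (\<lambda>j m i. if i < k then \<xi> j i else \<eta> m (i - k))"
  have eq: "(\<Prod>i<k. \<xi> j i v) * (\<Prod>i<l. \<eta> m i v) = (\<Prod>i<k + l. \<zeta> j m i v)" for j m v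
  proof -
    have "(\<Prod>i<k + l. \<zeta> j m i v) = (\<Prod>i<k. \<zeta> j m i v) * (\<Prod>i=k..<k + l. \<zeta> j m i v)"
      by (simp add: prod.atLeastLessThan_concat flip: atLeast0LessThan)
    also have "(\<Prod>i=k..<k + l. \<zeta> j m i v) = (\<Prod>i<l. \<eta> m i v)"
      using prod.shift_bounds_nat_ivl[of "\<lambda>i. \<zeta> j m i v" 0 k l]
      by (simp add: \<zeta>_def add.commute atLeast0LessThan)
    finally show ?thesis by (simp add: \<zeta>_def)
  qed
  have "p v * q v = (\<Sum>j<N. \<Sum>m<M. (a j * b m) * (\<Prod>i<k + l. \<zeta> j m i v))" for v
    unfolding p(2) q(2) sum_product
    by (intro sum.cong refl) (simp add: mult_ac flip: eq)
  moreover have "(\<lambda>v. \<Sum>j<N. \<Sum>m<M. (a j * b m) * (\<Prod>i<k + l. \<zeta> j m i v)) \<in> hom_poly sm (k + l)"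
    by (intro hom_poly_sum hom_poly_monomial) (use p(1) q(1) in \<open>auto simp: \<zeta>_def\<close>)
  ultimately show ?thesis by simp
qed

lemma hom_poly_const: "(\<lambda>v. a) \<in> hom_poly sm 0"
  using hom_poly_monomial[of 0 sm _ a] by simp

lemma hom_poly_linear_power:
  "Vector_Spaces.linear sm (*) \<xi> \<Longrightarrow> (\<lambda>v. \<xi> v ^ k) \<in> hom_poly sm k"
  using hom_poly_monomial[of k sm "\<lambda>_. \<xi>" 1] by simp

lemma hom_poly_scale:
  assumes "p \<in> hom_poly sm k"
  shows "p (sm a v) = a ^ k * p v"
proof -
  obtain N b \<xi> where p: "\<And>j i. j < N \<Longrightarrow> i < k \<Longrightarrow> Vector_Spaces.linear sm (*) (\<xi> j i)"
    "p = (\<lambda>v. \<Sum>j<(N::nat). b j * (\<Prod>i<k. \<xi> j i v))"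
    using assms unfolding hom_poly_def by blast
  have "(\<Prod>i<k. \<xi> j i (sm a v)) = a ^ k * (\<Prod>i<k. \<xi> j i v)" if "j < N" for j
  proof -
    have "(\<Prod>i<k. \<xi> j i (sm a v)) = (\<Prod>i<k. a * \<xi> j i v)"
      by (intro prod.cong refl linear_mult p(1) that) simp
    then show ?thesis by (simp add: prod.distrib)
  qed
  then show ?thesis
    by (simp add: p(2) sum_distrib_left mult.left_commute)
qed

section \<open>Lines\<close>

lemma mem_line:
  assumes "vector_space sm"
  shows "w \<in> line sm v \<longleftrightarrow> (\<exists>a. w = sm a v)"
proof -
  interpret V: vector_space sm by fact
  show ?thesis by (auto simp: line_def V.span_singleton)
qed

lemma self_in_line: "vector_space sm \<Longrightarrow> v \<in> line sm v"
  by (metis mem_line module.scale_one module_iff_vector_space)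

lemma line_eq:
  assumes "vector_space sm" "w \<in> line sm v" "w \<noteq> 0"
  shows "line sm w = line sm v"
proof -
  interpret V: vector_space sm by fact
  obtain a where a: "w = sm a v" using assms mem_line by metis
  with assms have "a \<noteq> 0" by auto
  with a have v: "v = sm (1 / a) w" by simp
  show ?thesis
  proof (intro equalityI subsetI)
    fix u assume "u \<in> line sm w"
    then show "u \<in> line sm v"
      using a mem_line[OF assms(1)] by (metis V.scale_scale)
  next
    fix u assume "u \<in> line sm v"
    then show "u \<in> line sm w"
      using v mem_line[OF assms(1)] by (metis V.scale_scale)
  qed
qed

lemma line_in_proj_space: "v \<noteq> 0 \<Longrightarrow> line sm v \<in> proj_space sm UNIV"
  by (auto simp: proj_space_def)

text \<open>An independent set extends to a basis, on which the values of a linear form are free.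
  Such forms give the witnesses for \<open>pow_nonzero\<close> and separate points in
  \<open>infinite_proj_space\<close>.\<close>

lemma exists_linear_form:
  assumes "vector_space sm" "\<not> module.dependent sm B"
  obtains \<xi> where "Vector_Spaces.linear sm (*) \<xi>" "\<forall>b\<in>B. \<xi> b = (g b :: complex)"
proof -
  interpret V: vector_space_pair sm "(*) :: complex \<Rightarrow> _"
    using assms(1) vector_space_complex by (simp add: vector_space_pair_def)
  show ?thesis
    using V.linear_independent_extend[OF assms(2), of g] that by blast
qed

lemma exists_linear_form_one:
  assumes "vector_space sm" "l \<noteq> 0"
  obtains \<xi> where "Vector_Spaces.linear sm (*) \<xi>" "\<xi> l = (1 :: complex)"
proof -
  interpret V: vector_space sm by fact
  have "V.independent {l}" using assms(2) by simp
  then show ?thesis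
    using exists_linear_form[OF assms(1), of "{l}" "\<lambda>_. 1"] that by auto
qed

section \<open>Regular functions\<close>

lemma zariski_openI:
  assumes "p \<in> hom_poly sm k"
  shows "zariski_open sm {line sm v | v. v \<noteq> 0 \<and> p v \<noteq> 0}"
  unfolding zariski_open_def by (rule exI[of _ "{p}"]) (use assms in auto)

lemma zariski_open_subset: "zariski_open sm W \<Longrightarrow> W \<subseteq> proj_space sm UNIV"
  by (auto simp: zariski_open_def proj_space_def)

text \<open>Two representatives of a line differ by a scalar, and \<open>p\<close> scales by its
  \<open>k\<close>-th power, so a zero at \<open>w\<close> would force one at
  \<open>v\<close>.\<close>

lemma hom_poly_nonzero_line:
  assumes "vector_space sm" "p \<in> hom_poly sm k" "p v \<noteq> 0" "line sm v = line sm w" "w \<noteq> 0"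
  shows "p w \<noteq> 0"
proof -
  obtain a where a: "v = sm a w"
    using assms by (metis mem_line self_in_line)
  show ?thesis using hom_poly_scale[OF assms(2), of a w] assms a by auto
qed

lemma zariski_open_Int:
  assumes "vector_space sm" "zariski_open sm U" "zariski_open sm W"
  shows "zariski_open sm (U \<inter> W)"
proof -
  obtain S T where S: "S \<subseteq> (\<Union>k. hom_poly sm k)" "U = {line sm v | v. v \<noteq> 0 \<and> (\<exists>p\<in>S. p v \<noteq> 0)}"
    using assms(2) unfolding zariski_open_def by (elim exE conjE)
  obtain T where T: "T \<subseteq> (\<Union>k. hom_poly sm k)" "W = {line sm v | v. v \<noteq> 0 \<and> (\<exists>p\<in>T. p v \<noteq> 0)}"
    using assms(3) unfolding zariski_open_def by (elim exE conjE)
  \<comment> \<open>A product is nonzero exactly where both factors are, so the pairwise products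
    cut out the intersection.\<close>
  define R where "R = {\<lambda>v. p v * q v | p q. p \<in> S \<and> q \<in> T}"
  have "R \<subseteq> (\<Union>k. hom_poly sm k)"
    using S(1) T(1) unfolding R_def by (blast intro: hom_poly_mult)
  moreover have "U \<inter> W = {line sm v | v. v \<noteq> 0 \<and> (\<exists>p\<in>R. p v \<noteq> 0)}" (is "_ = ?L")
  proof (intro equalityI subsetI)
    fix x assume "x \<in> U \<inter> W"
    then have "x \<in> U" "x \<in> W" by auto
    then obtain v w p q where *: "x = line sm v" "x = line sm w" "v \<noteq> 0" "w \<noteq> 0" "p \<in> S" "q \<in> T"
      "p v \<noteq> 0" "q w \<noteq> 0"
      unfolding S(2) T(2) mem_Collect_eq by (elim exE conjE bexE)
    \<comment> \<open>The point has a representative from each open set; nonvanishing of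
      \<open>q\<close> is moved to \<open>v\<close> so that both factors are evaluated at the same
      vector.\<close>
    then have "q v \<noteq> 0"
      using hom_poly_nonzero_line[OF assms(1), of q _ w v] T(1) by blast
    with * have "p v * q v \<noteq> 0" by simp
    moreover have "(\<lambda>v. p v * q v) \<in> R"
      using * unfolding R_def by blast
    ultimately show "x \<in> ?L"
      using *(1,3) by (intro CollectI exI[of _ v] conjI bexI[of _ "\<lambda>v. p v * q v"])
  next
    fix x assume "x \<in> ?L"
    then obtain v r where "x = line sm v" "v \<noteq> 0" "r \<in> R" "r v \<noteq> 0"
      by (elim CollectE exE conjE bexE)
    moreover then obtain p q where "r = (\<lambda>v. p v * q v)" "p \<in> S" "q \<in> T"
      unfolding R_def by blast
    ultimately show "x \<in> U \<inter> W"
      unfolding S(2) T(2) by (intro IntI CollectI exI[of _ v] conjI bexI[of _ p] bexI[of _ q]) auto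
  qed
  ultimately show ?thesis unfolding zariski_open_def by blast
qed

text \<open>The local condition inside \<open>regular_on\<close>, with one pair of polynomials for
  all of \<open>W\<close>. Algebra is done on these explicit quotients and then localised.\<close>

definition quotient_on ::
    "(complex \<Rightarrow> 'v \<Rightarrow> 'v) \<Rightarrow> 'v::ab_group_add set set \<Rightarrow> ('v set \<Rightarrow> complex) \<Rightarrow> bool"
  where "quotient_on sm W g \<longleftrightarrow> (\<exists>k p q. p \<in> hom_poly sm k \<and> q \<in> hom_poly sm k
        \<and> (\<forall>v. v \<noteq> 0 \<and> line sm v \<in> W \<longrightarrow> q v \<noteq> 0 \<and> g (line sm v) = p v / q v))"

lemma regular_on_iff:
  "regular_on sm U g \<longleftrightarrow>
    (\<forall>x\<in>U. \<exists>W. zariski_open sm W \<and> x \<in> W \<and> W \<subseteq> U \<and> quotient_on sm W g)"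
  unfolding regular_on_def quotient_on_def by simp

lemma quotient_onI:
  assumes "p \<in> hom_poly sm k" "q \<in> hom_poly sm k"
    "\<And>v. v \<noteq> 0 \<Longrightarrow> line sm v \<in> W \<Longrightarrow> q v \<noteq> 0"
    "\<And>v. v \<noteq> 0 \<Longrightarrow> line sm v \<in> W \<Longrightarrow> g (line sm v) = p v / q v"
  shows "quotient_on sm W g"
  unfolding quotient_on_def using assms by blast

lemma quotient_on_subset: "quotient_on sm U g \<Longrightarrow> W \<subseteq> U \<Longrightarrow> quotient_on sm W g"
  unfolding quotient_on_def by (meson subsetD)

lemma quotient_on_cong:
  "quotient_on sm U g \<Longrightarrow> (\<And>x. x \<in> U \<Longrightarrow> g x = h x) \<Longrightarrow> quotient_on sm U h"
  unfolding quotient_on_def by simp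

lemma
  assumes "quotient_on sm W g" "quotient_on sm W h"
  shows quotient_on_add: "quotient_on sm W (\<lambda>x. g x + h x)"
    and quotient_on_mult: "quotient_on sm W (\<lambda>x. g x * h x)"
proof -
  obtain k p q where g: "p \<in> hom_poly sm k" "q \<in> hom_poly sm k"
    "\<forall>v. v \<noteq> 0 \<and> line sm v \<in> W \<longrightarrow> q v \<noteq> 0 \<and> g (line sm v) = p v / q v"
    using assms(1) unfolding quotient_on_def by blast
  obtain k' p' q' where h: "p' \<in> hom_poly sm k'" "q' \<in> hom_poly sm k'"
    "\<forall>v. v \<noteq> 0 \<and> line sm v \<in> W \<longrightarrow> q' v \<noteq> 0 \<and> h (line sm v) = p' v / q' v"
    using assms(2) unfolding quotient_on_def by blast
  \<comment> \<open>Over the common denominator \<open>q q'\<close> both summands of the numerator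
    must have the same degree; this one comes out as \<open>k' + k\<close>.\<close>
  have p'q: "(\<lambda>v. p' v * q v) \<in> hom_poly sm (k + k')"
    using hom_poly_mult[OF h(1) g(2)] by (simp add: add.commute)
  show "quotient_on sm W (\<lambda>x. g x + h x)"
    by (rule quotient_onI[OF hom_poly_add[OF hom_poly_mult[OF g(1) h(2)] p'q]
          hom_poly_mult[OF g(2) h(2)]])
      (use g h in \<open>auto simp: field_simps\<close>)
  show "quotient_on sm W (\<lambda>x. g x * h x)"
    by (rule quotient_onI[OF hom_poly_mult[OF g(1) h(1)] hom_poly_mult[OF g(2) h(2)]])
      (use g h in \<open>auto simp: field_simps\<close>)
qed

lemma regular_on_local:
  assumes "\<And>x. x \<in> U \<Longrightarrow> \<exists>W. x \<in> W \<and> W \<subseteq> U \<and> regular_on sm W g"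
  shows "regular_on sm U g"
  using assms unfolding regular_on_iff by (meson order_trans)

lemma regular_on_subset:
  assumes "vector_space sm" "regular_on sm U g" "zariski_open sm W" "W \<subseteq> U"
  shows "regular_on sm W g"
  unfolding regular_on_iff
proof
  fix x assume x: "x \<in> W"
  then obtain W' where W': "zariski_open sm W'" "x \<in> W'" "quotient_on sm W' g"
    using assms(2,4) unfolding regular_on_iff by blast
  have "zariski_open sm (W \<inter> W')" "quotient_on sm (W \<inter> W') g"
    using zariski_open_Int assms(1,3) W'(1) quotient_on_subset[OF W'(3)] by auto
  then show "\<exists>W'. zariski_open sm W' \<and> x \<in> W' \<and> W' \<subseteq> W \<and> quotient_on sm W' g"
    using x W'(2) by blast
qed

lemma regular_on_cong:
  assumes "regular_on sm U g" "\<And>x. x \<in> U \<Longrightarrow> g x = h x"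
  shows "regular_on sm U h"
  unfolding regular_on_iff
proof
  fix x assume "x \<in> U"
  then obtain W where W: "zariski_open sm W" "x \<in> W" "W \<subseteq> U" "quotient_on sm W g"
    using assms(1) unfolding regular_on_iff by blast
  have "quotient_on sm W h"
    by (rule quotient_on_cong[OF W(4)]) (use assms(2) W(3) in auto)
  with W show "\<exists>W. zariski_open sm W \<and> x \<in> W \<and> W \<subseteq> U \<and> quotient_on sm W h"
    by blast
qed

lemma regular_on_quotient: "zariski_open sm U \<Longrightarrow> quotient_on sm U g \<Longrightarrow> regular_on sm U g"
  unfolding regular_on_iff by blast

lemma regular_on_const: "zariski_open sm U \<Longrightarrow> regular_on sm U (\<lambda>x. a)"
  by (erule regular_on_quotient, rule quotient_onI[OF hom_poly_const[of a] hom_poly_const[of 1]]) auto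

text \<open>Intersecting the two neighbourhoods of \<open>x\<close> gives one on which both
  functions are explicit quotients.\<close>

lemma regular_on_common_quotient:
  assumes "vector_space sm" "regular_on sm U g" "regular_on sm U h" "x \<in> U"
  obtains W where "zariski_open sm W" "x \<in> W" "W \<subseteq> U" "quotient_on sm W g" "quotient_on sm W h"
proof -
  obtain W W' where W: "zariski_open sm W" "x \<in> W" "W \<subseteq> U" "quotient_on sm W g"
    and W': "zariski_open sm W'" "x \<in> W'" "quotient_on sm W' h"
    using assms(2-4) unfolding regular_on_iff by blast
  show thesis
    by (rule that[of "W \<inter> W'"])
      (use W W' zariski_open_Int[OF assms(1) W(1) W'(1)] quotient_on_subset[OF W(4)]
        quotient_on_subset[OF W'(3)] in auto)
qed

lemma regular_on_add:
  assumes "vector_space sm" "regular_on sm U g" "regular_on sm U h"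
  shows "regular_on sm U (\<lambda>x. g x + h x)"
proof (rule regular_on_local)
  fix x assume "x \<in> U"
  then obtain W where W: "zariski_open sm W" "x \<in> W" "W \<subseteq> U" "quotient_on sm W g" "quotient_on sm W h"
    by (rule regular_on_common_quotient[OF assms])
  then show "\<exists>W. x \<in> W \<and> W \<subseteq> U \<and> regular_on sm W (\<lambda>x. g x + h x)"
    by (intro exI[of _ W] conjI regular_on_quotient quotient_on_add)
qed

lemma regular_on_mult:
  assumes "vector_space sm" "regular_on sm U g" "regular_on sm U h"
  shows "regular_on sm U (\<lambda>x. g x * h x)"
proof (rule regular_on_local)
  fix x assume "x \<in> U"
  then obtain W where W: "zariski_open sm W" "x \<in> W" "W \<subseteq> U" "quotient_on sm W g" "quotient_on sm W h"
    by (rule regular_on_common_quotient[OF assms])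
  then show "\<exists>W. x \<in> W \<and> W \<subseteq> U \<and> regular_on sm W (\<lambda>x. g x * h x)"
    by (intro exI[of _ W] conjI regular_on_quotient quotient_on_mult)
qed

lemma regular_on_sum:
  assumes "vector_space sm" "zariski_open sm U" "\<And>j. j \<in> J \<Longrightarrow> regular_on sm U (g j)"
  shows "regular_on sm U (\<lambda>x. \<Sum>j\<in>J. g j x)"
  using assms(3)
proof (induction J rule: infinite_finite_induct)
  case (insert j J)
  then have "regular_on sm U (g j)" "regular_on sm U (\<lambda>x. \<Sum>j\<in>J. g j x)"
    by simp_all
  from regular_on_add[OF assms(1) this] show ?case
    using insert.hyps by simp
qed (simp_all add: regular_on_const[OF assms(2)])

section \<open>Sections of vector bundles\<close>

lemma fun_scale_apply [simp]: "fun_scale sc a g x = sc a (g x)"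
  by (simp add: fun_scale_def)

text \<open>Charts and elements of the fibres of \<open>hom_bundle\<close> are linear only on a
  fibre, not on the whole ambient type, so the induction has to keep every partial sum inside
  \<open>S\<close>.\<close>

lemma linear_sum_on_subspace:
  assumes "vector_space sc" "module.subspace sc S"
    and add: "\<And>w w'. w \<in> S \<Longrightarrow> w' \<in> S \<Longrightarrow> \<alpha> (w + w') = \<alpha> w + \<alpha> w'"
    and scale: "\<And>a w. w \<in> S \<Longrightarrow> \<alpha> (sc a w) = sc' a (\<alpha> w)"
    and "\<And>l. l \<in> L \<Longrightarrow> w l \<in> S"
  shows "\<alpha> (\<Sum>l\<in>L. sc (a l) (w l)) = (\<Sum>l\<in>L. sc' (a l) (\<alpha> (w l) :: 'u::ab_group_add))"
proof -
  interpret V: vector_space sc by fact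
  have zero: "\<alpha> 0 = 0"
    using add[of 0 0] V.subspace_0[OF assms(2)] by simp
  show ?thesis
    using assms(5)
  proof (induction L rule: infinite_finite_induct)
    case (insert l L)
    have "(\<Sum>l\<in>L. sc (a l) (w l)) \<in> S" "sc (a l) (w l) \<in> S"
      using insert.prems assms(2) by (auto intro!: V.subspace_sum V.subspace_scale)
    then show ?case
      using insert by (simp add: add scale)
  qed (simp_all add: zero)
qed

lemma vector_bundleD:
  assumes "vector_bundle sm E"
  shows "vector_space (bscale E)"
    and "x \<in> proj_space sm UNIV \<Longrightarrow> module.subspace (bscale E) (fibre E x)"
    and "(U, \<phi>) \<in> charts E \<Longrightarrow> zariski_open sm U"
    and "(U, \<phi>) \<in> charts E \<Longrightarrow> x \<in> U \<Longrightarrow> bij_betw (\<phi> x) (fibre E x) UNIV"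
    and "(U, \<phi>) \<in> charts E \<Longrightarrow> x \<in> U \<Longrightarrow> w \<in> fibre E x \<Longrightarrow> w' \<in> fibre E x
      \<Longrightarrow> \<phi> x (w + w') = \<phi> x w + \<phi> x w'"
    and "(U, \<phi>) \<in> charts E \<Longrightarrow> x \<in> U \<Longrightarrow> w \<in> fibre E x
      \<Longrightarrow> \<phi> x (bscale E a w) = a *s \<phi> x w"
    and "x \<in> proj_space sm UNIV \<Longrightarrow> \<exists>C\<in>charts E. x \<in> fst C"
proof -
  show "vector_space (bscale E)"
    and "x \<in> proj_space sm UNIV \<Longrightarrow> module.subspace (bscale E) (fibre E x)"
    and "(U, \<phi>) \<in> charts E \<Longrightarrow> zariski_open sm U"
    and "(U, \<phi>) \<in> charts E \<Longrightarrow> x \<in> U \<Longrightarrow> bij_betw (\<phi> x) (fibre E x) UNIV"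
    and "(U, \<phi>) \<in> charts E \<Longrightarrow> x \<in> U \<Longrightarrow> w \<in> fibre E x \<Longrightarrow> w' \<in> fibre E x
      \<Longrightarrow> \<phi> x (w + w') = \<phi> x w + \<phi> x w'"
    and "(U, \<phi>) \<in> charts E \<Longrightarrow> x \<in> U \<Longrightarrow> w \<in> fibre E x
      \<Longrightarrow> \<phi> x (bscale E a w) = a *s \<phi> x w"
    using assms unfolding vector_bundle_def by auto
  assume "x \<in> proj_space sm UNIV"
  moreover have "(\<Union>(U, \<phi>)\<in>charts E. U) = proj_space sm UNIV"
    using assms unfolding vector_bundle_def by blast
  ultimately have "x \<in> (\<Union>(U, \<phi>)\<in>charts E. U)" by simp
  then show "\<exists>C\<in>charts E. x \<in> fst C"
    by (auto simp: split_def)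
qed

text \<open>The preimages of the standard basis vectors form a frame of the fibre: \<open>w\<close>
  and its expansion have the same coordinates, and the chart is injective on the fibre.\<close>

lemma chart_frame:
  fixes E :: "('v::ab_group_add, 'w::ab_group_add, 'e::finite) vbundle"
  assumes "vector_space sm" "vector_bundle sm E" "(U, \<phi>) \<in> charts E" "x \<in> U"
  defines "e \<equiv> \<lambda>k. inv_into (fibre E x) (\<phi> x) (axis k 1)"
  shows "e k \<in> fibre E x"
    and "w \<in> fibre E x \<Longrightarrow> w = (\<Sum>k\<in>UNIV. bscale E (\<phi> x w $ k) (e k))"
proof -
  have "zariski_open sm U" and vs: "vector_space (bscale E)"
    and bij: "bij_betw (\<phi> x) (fibre E x) UNIV"
    and lin: "\<And>w w'. w \<in> fibre E x \<Longrightarrow> w' \<in> fibre E x \<Longrightarrow> \<phi> x (w + w') = \<phi> x w + \<phi> x w'"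
      "\<And>a w. w \<in> fibre E x \<Longrightarrow> \<phi> x (bscale E a w) = a *s \<phi> x w"
    using vector_bundleD[OF assms(2)] assms(3,4) by auto
  then have "x \<in> proj_space sm UNIV"
    using assms(4) zariski_open_subset by blast
  then have sub: "module.subspace (bscale E) (fibre E x)"
    by (rule vector_bundleD[OF assms(2)])
  interpret V: vector_space "bscale E" by fact
  have e: "e k \<in> fibre E x" "\<phi> x (e k) = axis k 1" for k
    using bij unfolding e_def
    by (auto simp: bij_betw_def f_inv_into_f intro: inv_into_into)
  then show "e k \<in> fibre E x" by simp
  assume w: "w \<in> fibre E x"
  have "\<phi> x (\<Sum>k\<in>UNIV. bscale E (\<phi> x w $ k) (e k)) = (\<Sum>k\<in>UNIV. (\<phi> x w $ k) *s \<phi> x (e k))"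
    by (rule linear_sum_on_subspace[OF vs sub]) (use lin e in auto)
  also have "\<dots> = \<phi> x w"
    by (simp add: e basis_expansion)
  finally have "\<phi> x w = \<phi> x (\<Sum>k\<in>UNIV. bscale E (\<phi> x w $ k) (e k))" ..
  moreover have "(\<Sum>k\<in>UNIV. bscale E (\<phi> x w $ k) (e k)) \<in> fibre E x"
    by (intro V.subspace_sum[OF sub] V.subspace_scale[OF sub] e(1))
  ultimately show "w = (\<Sum>k\<in>UNIV. bscale E (\<phi> x w $ k) (e k))"
    using inj_onD[OF bij_betw_imp_inj_on[OF bij]] w by blast
qed

section \<open>Sections of O(d) and of Hom(E, O(d))\<close>

lemma H0_O_bundle:
  "h \<in> H0 sm (O_bundle sm d) \<longleftrightarrow>
     (\<forall>x\<in>proj_space sm UNIV. (\<forall>v. v \<notin> x \<longrightarrow> h x v = 0) \<and> (\<forall>a. \<forall>v\<in>x. h x (sm a v) = a ^ d * h x v))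
   \<and> (\<forall>x. x \<notin> proj_space sm UNIV \<longrightarrow> h x = 0)
   \<and> (\<forall>\<xi>. Vector_Spaces.linear sm (*) \<xi> \<longrightarrow>
        regular_on sm {line sm v | v. \<xi> v \<noteq> 0} (\<lambda>x. h x (THE v. v \<in> x \<and> \<xi> v = 1)))"
proof -
  have "(\<forall>(U, \<phi>)\<in>charts (O_bundle sm d). \<forall>k. regular_on sm U (\<lambda>x. \<phi> x (h x) $ k)) \<longleftrightarrow>
    (\<forall>\<xi>. Vector_Spaces.linear sm (*) \<xi> \<longrightarrow>
        regular_on sm {line sm v | v. \<xi> v \<noteq> 0} (\<lambda>x. h x (THE v. v \<in> x \<and> \<xi> v = 1)))"
    unfolding O_bundle_def by (simp add: setcompr_eq_image)
  then show ?thesis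
    by (auto simp: H0_def O_bundle_def)
qed

lemma H0_O_bundleD:
  assumes "h \<in> H0 sm (O_bundle sm d)" "x \<in> proj_space sm UNIV"
  shows "v \<notin> x \<Longrightarrow> h x v = 0" "v \<in> x \<Longrightarrow> h x (sm a v) = a ^ d * h x v"
  using assms unfolding H0_O_bundle by auto

lemma hyperplane_complement_open:
  assumes "Vector_Spaces.linear sm (*) \<xi>"
  shows "zariski_open sm {line sm v | v. \<xi> v \<noteq> (0::complex)}"
proof -
  \<comment> \<open>A linear form vanishes at 0, so the condition that \<open>v\<close> be nonzero
    is automatic; the exponent 1 exhibits \<xi> as a polynomial of degree 1.\<close>
  have "{line sm v | v. \<xi> v \<noteq> 0} = {line sm v | v. v \<noteq> 0 \<and> \<xi> v ^ 1 \<noteq> 0}"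
    using linear_zero[OF assms] by auto
  then show ?thesis
    using zariski_openI[OF hom_poly_linear_power[OF assms, of 1]] by simp
qed

text \<open>Among the multiples of \<open>v\<close>, the condition \<xi> = 1 determines the scalar.
  At this vector the chart of O(d) belonging to \<xi> evaluates a section.\<close>

lemma the_normalised:
  assumes "vector_space sm" "Vector_Spaces.linear sm (*) \<xi>" "\<xi> v \<noteq> (0::complex)"
  shows "(THE u. u \<in> line sm v \<and> \<xi> u = 1) = sm (1 / \<xi> v) v"
proof (rule the_equality)
  show "sm (1 / \<xi> v) v \<in> line sm v \<and> \<xi> (sm (1 / \<xi> v) v) = 1"
    using assms by (auto simp: mem_line linear_mult)
next
  fix u assume "u \<in> line sm v \<and> \<xi> u = 1"
  then obtain a where "u = sm a v" "a * \<xi> v = 1"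
    using assms by (auto simp: mem_line linear_mult)
  moreover from this(2) have "a = 1 / \<xi> v"
    using assms(3) by (simp add: field_simps)
  ultimately show "u = sm (1 / \<xi> v) v" by simp
qed

lemma hom_bundle_section_regular:
  assumes "t \<in> H0 sm (hom_bundle E F)" "(U, \<phi>) \<in> charts E" "(U', \<psi>) \<in> charts F"
  shows "regular_on sm (U \<inter> U') (\<lambda>x. \<psi> x (t x (inv_into (fibre E x) (\<phi> x) (axis k 1))) $ l)"
proof -
  let ?M = "\<lambda>x \<alpha>. \<chi> kl. \<psi> x (\<alpha> (inv_into (fibre E x) (\<phi> x) (axis (snd kl) 1))) $ fst kl"
  have "(U \<inter> U', ?M) \<in> charts (hom_bundle E F)"
    unfolding hom_bundle_def using assms(2,3) by (simp, intro exI conjI) auto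
  then have "\<forall>kl. regular_on sm (U \<inter> U') (\<lambda>x. ?M x (t x) $ kl)"
    using assms(1) unfolding H0_def by auto
  from spec[OF this, of "(l, k)"] show ?thesis by simp
qed

text \<open>In a frame of \<open>E\<close> the contraction is the sum of the coordinates of
  \<open>s\<close> times the matrix entries of \<open>t\<close>, all of them regular. Membership
  matters because \<open>pow\<close> is 0 outside the sections of O(d).\<close>

lemma contraction_in_H0:
  fixes E :: "('v::ab_group_add, 'w::ab_group_add, 'e::finite) vbundle"
  assumes vs: "vector_space sm" and E: "vector_bundle sm E"
    and s: "s \<in> H0 sm E" and t: "t \<in> H0 sm (hom_bundle E (O_bundle sm d))"
  shows "contraction s t \<in> H0 sm (O_bundle sm d)"
proof -
  have tx: "t x \<in> lin_maps (bscale E) (fibre E x) (fun_scale (*))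
      {h. (\<forall>v. v \<notin> x \<longrightarrow> h v = 0) \<and> (\<forall>a. \<forall>v\<in>x. h (sm a v) = a ^ d * h v)}"
    if "x \<in> proj_space sm UNIV" for x
    using t that unfolding H0_def hom_bundle_def O_bundle_def by auto
  have sx: "s x \<in> fibre E x" if "x \<in> proj_space sm UNIV" for x
    using s that unfolding H0_def by auto
  have reg: "regular_on sm {line sm v | v. \<xi> v \<noteq> 0} (\<lambda>x. t x (s x) (THE v. v \<in> x \<and> \<xi> v = 1))"
    if \<xi>: "Vector_Spaces.linear sm (*) \<xi>" for \<xi>
  proof (rule regular_on_local)
    let ?H = "{line sm v | v. \<xi> v \<noteq> 0}"
    let ?u = "\<lambda>x. THE v. v \<in> x \<and> \<xi> v = 1"
    fix x assume x: "x \<in> ?H"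
    have H: "zariski_open sm ?H"
      by (rule hyperplane_complement_open[OF \<xi>])
    then have "x \<in> proj_space sm UNIV"
      using zariski_open_subset x by blast
    \<comment> \<open>The set where \<xi> is nonzero need not lie in one chart of \<open>E\<close>,
      so regularity is checked near each point, on the intersection with a chart.\<close>
    then obtain U \<phi> where U: "(U, \<phi>) \<in> charts E" "x \<in> U"
      using vector_bundleD(7)[OF E] by fastforce
    have "zariski_open sm U"
      by (rule vector_bundleD(3)[OF E U(1)])
    then have W: "zariski_open sm (U \<inter> ?H)"
      using zariski_open_Int[OF vs _ H] by blast
    let ?e = "\<lambda>y k. inv_into (fibre E y) (\<phi> y) (axis k 1)"
    have "regular_on sm U (\<lambda>y. \<phi> y (s y) $ k)" for k
      using s U(1) unfolding H0_def by auto
    then have 1: "regular_on sm (U \<inter> ?H) (\<lambda>y. \<phi> y (s y) $ k)" for k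
      using regular_on_subset[OF vs _ W] by blast
    have chart: "(?H, \<lambda>y h. \<chi> _::1. h (?u y)) \<in> charts (O_bundle sm d)"
      using \<xi> unfolding O_bundle_def by auto
    have 2: "regular_on sm (U \<inter> ?H) (\<lambda>y. t y (?e y k) (?u y))" for k
      using hom_bundle_section_regular[OF t U(1) chart, of k 1] by simp
    have "regular_on sm (U \<inter> ?H) (\<lambda>y. \<Sum>k\<in>UNIV. \<phi> y (s y) $ k * t y (?e y k) (?u y))"
      by (intro regular_on_sum[OF vs W] regular_on_mult[OF vs 1 2])
    then have "regular_on sm (U \<inter> ?H) (\<lambda>y. t y (s y) (?u y))"
    proof (rule regular_on_cong)
      fix y assume y: "y \<in> U \<inter> ?H"
      then have yP: "y \<in> proj_space sm UNIV"
        using zariski_open_subset[OF W] by blast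
      have "t y (s y) = t y (\<Sum>k\<in>UNIV. bscale E (\<phi> y (s y) $ k) (?e y k))"
        using chart_frame(2)[OF vs E U(1) _ sx[OF yP]] y by simp
      also have "\<dots> = (\<Sum>k\<in>UNIV. fun_scale (*) (\<phi> y (s y) $ k) (t y (?e y k)))"
      proof (rule linear_sum_on_subspace)
        show "vector_space (bscale E)" "module.subspace (bscale E) (fibre E y)"
          using vector_bundleD(1,2)[OF E] yP by auto
        show "?e y k \<in> fibre E y" for k
          using chart_frame(1)[OF vs E U(1)] y by simp
      qed (use tx[OF yP] in \<open>auto simp: lin_maps_def\<close>)
      finally show "(\<Sum>k\<in>UNIV. \<phi> y (s y) $ k * t y (?e y k) (?u y)) = t y (s y) (?u y)"
        by (simp add: sum_apply)
    qed
    then show "\<exists>W. x \<in> W \<and> W \<subseteq> ?H \<and> regular_on sm W (\<lambda>x. t x (s x) (?u x))"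
      using IntI[OF U(2) x] by (intro exI[of _ "U \<inter> ?H"] conjI Int_lower2)
  qed
  have "t x = 0" if "x \<notin> proj_space sm UNIV" for x
    using t that unfolding H0_def by auto
  moreover have "t x (s x) \<in> {h. (\<forall>v. v \<notin> x \<longrightarrow> h v = 0) \<and> (\<forall>a. \<forall>v\<in>x. h (sm a v) = a ^ d * h v)}"
    if "x \<in> proj_space sm UNIV" for x
    using tx[OF that] sx[OF that] unfolding lin_maps_def by blast
  ultimately show ?thesis
    unfolding H0_O_bundle contraction_def using reg by simp
qed

section \<open>The linear structure on the sections of O(d)\<close>

lemma H0_O_bundle_add:
  assumes "vector_space sm" "h \<in> H0 sm (O_bundle sm d)" "h' \<in> H0 sm (O_bundle sm d)"
  shows "h + h' \<in> H0 sm (O_bundle sm d)"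
  using assms(2,3) regular_on_add[OF assms(1)] unfolding H0_O_bundle
  by (simp add: algebra_simps)

lemma H0_O_bundle_scale:
  assumes "vector_space sm" "h \<in> H0 sm (O_bundle sm d)"
  shows "fun_scale (fun_scale (*)) a h \<in> H0 sm (O_bundle sm d)"
  using assms(2) regular_on_mult[OF assms(1) regular_on_const[OF hyperplane_complement_open]]
  unfolding H0_O_bundle by (auto simp: fun_eq_iff)

section \<open>The Veronese variety\<close>

lemma pow_in_sym_power:
  assumes "vector_space sm"
  shows "pow sm d l \<in> sym_power sm d"
proof -
  have "bscale (O_bundle sm d) = fun_scale (*)"
    by (simp add: O_bundle_def)
  then show ?thesis
    unfolding sym_power_def dual_space_def lin_maps_def pow_def
    using H0_O_bundle_add[OF assms] H0_O_bundle_scale[OF assms] by auto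
qed

lemma pow_scale:
  assumes "vector_space sm" "l \<noteq> 0" "a \<noteq> 0"
  shows "pow sm d (sm a l) = tscale (a ^ d) (pow sm d l)"
proof -
  interpret V: vector_space sm by fact
  have "line sm (sm a l) = line sm l"
    using assms mem_line[OF assms(1)] by (intro line_eq) auto
  then show ?thesis
    using H0_O_bundleD(2)[OF _ line_in_proj_space[OF assms(2)] self_in_line[OF assms(1)]]
    by (auto simp: pow_def fun_eq_iff)
qed

text \<open>The line spanned by 0 is not a point of projective space, so sections are 0 there by
  convention. This case is apart from \<open>pow_scale\<close>, whose formula would fail for
  \<open>a = 0\<close> and \<open>d = 0\<close>.\<close>

lemma pow_zero:
  assumes "vector_space sm"
  shows "pow sm d 0 = 0"
proof -
  have "h (line sm 0) 0 = 0" if "h \<in> H0 sm (O_bundle sm d)" for h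
  proof -
    have "line sm 0 \<notin> proj_space sm UNIV"
    proof
      assume "line sm 0 \<in> proj_space sm UNIV"
      then obtain w where "w \<noteq> 0" "line sm 0 = line sm w"
        by (auto simp: proj_space_def)
      moreover have "line sm 0 = {0}"
        using mem_line[OF assms] assms
        by (auto simp: module.scale_zero_right module_iff_vector_space[symmetric])
      ultimately show False
        using self_in_line[OF assms] by blast
    qed
    with that show ?thesis
      unfolding H0_O_bundle by simp
  qed
  then show ?thesis
    by (auto simp: pow_def fun_eq_iff)
qed

lemma pow_nonzero:
  assumes "vector_space sm" "l \<noteq> 0"
  shows "pow sm d l \<noteq> 0"
proof -
  obtain \<eta> where \<eta>: "Vector_Spaces.linear sm (*) \<eta>" "\<eta> l = (1::complex)"
    using exists_linear_form_one[OF assms] .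
  \<comment> \<open>The section \<eta>^d, which takes the value 1 at \<open>l\<close>; in the chart
    given by \<xi> it is the quotient of \<eta>^d by \<xi>^d.\<close>
  define h where "h = (\<lambda>x v. if x \<in> proj_space sm UNIV \<and> v \<in> x then \<eta> v ^ d else 0)"
  have "regular_on sm {line sm v | v. \<xi> v \<noteq> 0} (\<lambda>x. h x (THE v. v \<in> x \<and> \<xi> v = 1))"
    if \<xi>: "Vector_Spaces.linear sm (*) \<xi>" for \<xi>
  proof (rule regular_on_quotient[OF hyperplane_complement_open[OF \<xi>] quotient_onI
        [OF hom_poly_linear_power[OF \<eta>(1), of d] hom_poly_linear_power[OF \<xi>, of d]]])
    fix v assume v: "v \<noteq> 0" "line sm v \<in> {line sm v | v. \<xi> v \<noteq> 0}"
    then obtain w where w: "line sm w = line sm v" "\<xi> w \<noteq> 0" by auto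
    then have "\<xi> w ^ 1 \<noteq> 0" by simp
    then have "\<xi> v ^ 1 \<noteq> 0"
      using hom_poly_nonzero_line[OF assms(1) hom_poly_linear_power[OF \<xi>, of 1]] w v by blast
    then have "\<xi> v \<noteq> 0" by simp
    then show "\<xi> v ^ d \<noteq> 0" by simp
    show "h (line sm v) (THE u. u \<in> line sm v \<and> \<xi> u = 1) = \<eta> v ^ d / \<xi> v ^ d"
      unfolding the_normalised[OF assms(1) \<xi> \<open>\<xi> v \<noteq> 0\<close>]
      using v line_in_proj_space mem_line[OF assms(1)]
      by (auto simp: h_def linear_mult[OF \<eta>(1)] power_divide)
  qed
  moreover have "sm a v \<in> x" if "x \<in> proj_space sm UNIV" "v \<in> x" for x v a
    using that mem_line[OF assms(1)] assms(1)
    by (auto simp: proj_space_def) (metis module.scale_scale module_iff_vector_space)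
  ultimately have "h \<in> H0 sm (O_bundle sm d)"
    unfolding H0_O_bundle
    by (auto simp: h_def fun_eq_iff linear_mult[OF \<eta>(1)] power_mult_distrib)
  moreover have "h (line sm l) l = 1"
    using assms \<eta> by (simp add: h_def line_in_proj_space self_in_line)
  ultimately have "pow sm d l h = 1"
    by (simp add: pow_def)
  then show ?thesis by auto
qed

text \<open>The image of a line under \<open>pow\<close> consists of multiples of
  \<open>pow sm d l\<close>, including 0 from the origin, and contains \<open>pow sm d l\<close>
  itself, so both have the same span.\<close>

lemma veronese_line:
  assumes "vector_space sm" "l \<noteq> 0"
  shows "veronese sm d (line sm l) = line tscale (pow sm d l)"
proof -
  interpret T: vector_space tscale by (rule vector_space_fun_scale)
  have "pow sm d ` line sm l \<subseteq> T.span {pow sm d l}"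
  proof
    fix u assume "u \<in> pow sm d ` line sm l"
    then obtain a where "u = pow sm d (sm a l)"
      using mem_line[OF assms(1)] by auto
    moreover have "sm 0 l = 0"
      using assms(1) by (metis module.scale_zero_left module_iff_vector_space)
    ultimately show "u \<in> T.span {pow sm d l}"
      using pow_scale[OF assms, of a d] pow_zero[OF assms(1)]
      by (cases "a = 0") (auto intro: T.span_zero T.span_scale T.span_base)
  qed
  moreover have "pow sm d l \<in> pow sm d ` line sm l"
    using self_in_line[OF assms(1)] by blast
  ultimately show ?thesis
    unfolding veronese_def line_def
    by (metis (no_types, lifting) T.span_eq T.span_superset empty_subsetI insert_subset subset_iff)
qed

section \<open>The rank of \<open>A\<^sub>f\<close>\<close>

text \<open>The set \<open>T\<close> forces a basis chosen from the family to have at least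
  \<open>card I\<close> elements. So the family has no repetitions and is itself that basis.\<close>

lemma independent_of_dim_eq_card:
  assumes "vector_space sc" "finite I"
    and T: "T \<subseteq> module.span sc (\<beta> ` I)" "vector_space.dim sc T = card I"
    and zero: "(\<Sum>i\<in>I. sc (y i) (\<beta> i)) = 0" and i: "i \<in> I"
  shows "y i = 0"
proof -
  interpret V: vector_space sc by fact
  obtain B where B: "B \<subseteq> \<beta> ` I" "V.independent B" "\<beta> ` I \<subseteq> V.span B"
    using V.maximal_independent_subset by blast
  have fin: "finite B" using B(1) assms(2) by (auto intro: finite_subset)
  have "T \<subseteq> V.span B"
    using T(1) B(3) V.span_minimal V.subspace_span by blast
  then have "card I \<le> card B"
    using V.dim_le_card fin T(2) by metis
  moreover have "card B \<le> card (\<beta> ` I)"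
    using B(1) assms(2) by (simp add: card_mono)
  moreover have "card (\<beta> ` I) \<le> card I"
    using assms(2) by (rule card_image_le)
  ultimately have "card B = card (\<beta> ` I)" "card (\<beta> ` I) = card I"
    by simp_all
  then have "B = \<beta> ` I" and inj: "inj_on \<beta> I"
    using B(1) assms(2) by (simp_all add: card_subset_eq eq_card_imp_inj_on)
  then have ind: "V.independent (\<beta> ` I)" using B(2) by simp
  \<comment> \<open>Injectivity turns the relation indexed by \<open>I\<close> into one between the
    elements of the image set, to which independence applies.\<close>
  have "(\<Sum>v\<in>\<beta> ` I. sc (y (inv_into I \<beta> v)) v) = (\<Sum>i\<in>I. sc (y i) (\<beta> i))"
    using inj by (simp add: sum.reindex inv_into_f_f)
  then have "y (inv_into I \<beta> (\<beta> i)) = 0"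
    using V.independentD[OF ind finite_imageI[OF assms(2)] order_refl, of "\<lambda>v. y (inv_into I \<beta> v)" "\<beta> i"]
      zero i by simp
  then show ?thesis using inj i by simp
qed

lemma decomposition_points_in_baseloc:
  fixes E :: "('v::ab_group_add, 'w::ab_group_add, 'e::finite) vbundle"
  assumes vs: "vector_space sm" and E: "vector_bundle sm E"
    and f: "f = (\<Sum>i<r. tscale (b i) (pow sm d (l i)))"
    and l: "\<And>i. i < r \<Longrightarrow> l i \<noteq> 0"
    and rank: "A_rank sm d f E = r * CARD('e)" and j: "j < r"
  shows "line sm (l j) \<in> baseloc sm (A_ker sm d f E)"
proof -
  let ?x = "\<lambda>i. line sm (l i)"
  have xP: "?x i \<in> proj_space sm UNIV" if "i < r" for i
    using l[OF that] by (rule line_in_proj_space)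
  have "\<exists>C. C \<in> charts E \<and> ?x i \<in> fst C" if "i < r" for i
    using vector_bundleD(7)[OF E xP[OF that]] by blast
  then obtain C where C: "\<And>i. i < r \<Longrightarrow> C i \<in> charts E \<and> ?x i \<in> fst (C i)"
    by metis
  define \<phi> where "\<phi> i = snd (C i) (?x i)" for i
  define e where "e i k = inv_into (fibre E (?x i)) (\<phi> i) (axis k 1)" for i k
  have e: "e i k \<in> fibre E (?x i)"
    and frame: "w \<in> fibre E (?x i) \<Longrightarrow> w = (\<Sum>k\<in>UNIV. bscale E (\<phi> i w $ k) (e i k))"
    if "i < r" for i k w
    using chart_frame[OF vs E, of "fst (C i)" "snd (C i)" "?x i"] C[OF that]
    unfolding e_def \<phi>_def by auto
  have sx: "s (?x i) \<in> fibre E (?x i)" if "s \<in> H0 sm E" "i < r" for s i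
    using that xP unfolding H0_def by blast
  \<comment> \<open>The matrix entry of \<open>t\<close> in direction \<open>k\<close> of the frame
    at the \<open>i\<close>-th point, evaluated at \<open>l i\<close> and weighted by
    \<open>b i\<close>. The default 0 agrees with that of \<open>A_map\<close>, so that the
    expansion below holds as an equality of functions.\<close>
  define \<beta> where "\<beta> = (\<lambda>(i, k) t. if t \<in> H0 sm (hom_bundle E (O_bundle sm d))
      then b i * t (?x i) (e i k) (l i) else 0)"
  let ?I = "{..<r} \<times> (UNIV :: 'e set)"
  have A: "A_map sm d f E s = (\<Sum>p\<in>?I. fun_scale (*) (\<phi> (fst p) (s (?x (fst p))) $ snd p) (\<beta> p))"
    if s: "s \<in> H0 sm E" for s
  proof
    fix t
    show "A_map sm d f E s t
        = (\<Sum>p\<in>?I. fun_scale (*) (\<phi> (fst p) (s (?x (fst p))) $ snd p) (\<beta> p)) t"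
    proof (cases "t \<in> H0 sm (hom_bundle E (O_bundle sm d))")
      case True
      have tx: "t (?x i) (s (?x i)) (l i) = (\<Sum>k\<in>UNIV. \<phi> i (s (?x i)) $ k * t (?x i) (e i k) (l i))"
        if "i < r" for i
      proof -
        have "t (?x i) (s (?x i)) = t (?x i) (\<Sum>k\<in>UNIV. bscale E (\<phi> i (s (?x i)) $ k) (e i k))"
          using frame[OF that sx[OF s that]] by simp
        also have "\<dots> = (\<Sum>k\<in>UNIV. fun_scale (*) (\<phi> i (s (?x i)) $ k) (t (?x i) (e i k)))"
        proof (rule linear_sum_on_subspace)
          show "vector_space (bscale E)" "module.subspace (bscale E) (fibre E (?x i))"
            using vector_bundleD(1,2)[OF E] xP[OF that] by auto
          have "t (?x i) \<in> lin_maps (bscale E) (fibre E (?x i)) (fun_scale (*)) (fibre (O_bundle sm d) (?x i))"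
            using True xP[OF that] unfolding H0_def hom_bundle_def O_bundle_def by auto
          then show "t (?x i) (w + w') = t (?x i) w + t (?x i) w'"
            "t (?x i) (bscale E a w) = fun_scale (*) a (t (?x i) w)"
            if "w \<in> fibre E (?x i)" "w' \<in> fibre E (?x i)" for w w' a
            using that unfolding lin_maps_def by auto
        qed (use e[OF that] in auto)
        finally show ?thesis by (simp add: sum_apply)
      qed
      \<comment> \<open>Each \<open>pow\<close> evaluates the contraction at \<open>l i\<close>
        rather than returning its default, since the contraction is a section of O(d).\<close>
      have "A_map sm d f E s t = (\<Sum>i<r. b i * t (?x i) (s (?x i)) (l i))"
        using True contraction_in_H0[OF vs E s True]
        by (simp add: A_map_def f sum_apply pow_def contraction_def)
      also have "\<dots> = (\<Sum>i<r. \<Sum>k\<in>UNIV. \<phi> i (s (?x i)) $ k * (b i * t (?x i) (e i k) (l i)))"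
        by (intro sum.cong refl) (simp add: tx sum_distrib_left mult.left_commute)
      also have "\<dots> = (\<Sum>p\<in>?I. fun_scale (*) (\<phi> (fst p) (s (?x (fst p))) $ snd p) (\<beta> p)) t"
        using True by (simp add: sum.cartesian_product sum_apply \<beta>_def split_def)
      finally show ?thesis .
    qed (simp add: A_map_def \<beta>_def sum_apply split_def)
  qed
  interpret F: vector_space "fun_scale (*) :: complex \<Rightarrow>
      (('v set \<Rightarrow> 'w \<Rightarrow> 'v \<Rightarrow> complex) \<Rightarrow> complex) \<Rightarrow> _"
    by (rule vector_space_fun_scale)
  have "A_map sm d f E ` H0 sm E \<subseteq> F.span (\<beta> ` ?I)"
  proof (rule image_subsetI)
    fix s assume "s \<in> H0 sm E"
    show "A_map sm d f E s \<in> F.span (\<beta> ` ?I)"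
      unfolding A[OF \<open>s \<in> H0 sm E\<close>] by (intro F.span_sum F.span_scale F.span_base imageI)
  qed
  moreover have "F.dim (A_map sm d f E ` H0 sm E) = card ?I"
    using rank by (simp add: A_rank_def)
  \<comment> \<open>The image of \<open>A_map\<close> has dimension equal to the number of
    functionals \<beta>, so a vanishing combination of them has zero coefficients, and these are the
    coordinates of \<open>s\<close> at the points.\<close>
  ultimately have inj: "\<phi> i (s (?x i)) $ k = 0"
    if "s \<in> H0 sm E" "A_map sm d f E s = 0" "i < r" for s i k
    using independent_of_dim_eq_card[OF F.vector_space_axioms _ _ _ _ , of ?I _ \<beta>
        "\<lambda>p. \<phi> (fst p) (s (?x (fst p))) $ snd p" "(i, k)"] A[OF that(1)] that(2,3)
    by auto
  interpret W: vector_space "bscale E"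
    by (rule vector_bundleD(1)[OF E])
  have "s (?x j) = 0" if "s \<in> A_ker sm d f E" for s
  proof -
    have s: "s \<in> H0 sm E" "A_map sm d f E s = 0"
      using that unfolding A_ker_def by auto
    show ?thesis
      using frame[OF j sx[OF s(1) j]] by (simp add: inj[OF s j])
  qed
  then show ?thesis
    using xP[OF j] by (simp add: baseloc_def)
qed

section \<open>From classes in the Veronese variety to powers of vectors\<close>

lemma veronese_representative:
  assumes "vector_space sm" "l \<noteq> 0" "line tscale u = veronese sm d (line sm l)"
  obtains b where "u = tscale b (pow sm d l)"
  using assms mem_line[OF vector_space_fun_scale] self_in_line[OF vector_space_fun_scale]
  by (metis veronese_line)

lemma waring_decomp_points_in_baseloc:
  fixes E :: "('v::ab_group_add, 'w::ab_group_add, 'e::finite) vbundle"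
  assumes vs: "vector_space sm" and E: "vector_bundle sm E"
    and dec: "waring_decomp sm d f r c v"
    and rank: "A_rank sm d f E = r * CARD('e)"
  shows "(\<lambda>i. line tscale (v i)) ` {..<r} \<subseteq> veronese sm d ` baseloc sm (A_ker sm d f E)"
proof -
  have "\<exists>l b. l \<noteq> 0 \<and> line tscale (v i) = veronese sm d (line sm l) \<and> v i = tscale b (pow sm d l)"
    if "i < r" for i
  proof -
    have "line tscale (v i) \<in> veronese_variety sm d"
      using dec that unfolding waring_decomp_def by blast
    then obtain l where "l \<noteq> 0" "line tscale (v i) = veronese sm d (line sm l)"
      unfolding veronese_variety_def proj_space_def by blast
    then show ?thesis
      using veronese_representative[OF vs] by metis
  qed
  then obtain l b where l: "\<And>i. i < r \<Longrightarrow> l i \<noteq> 0"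
    "\<And>i. i < r \<Longrightarrow> line tscale (v i) = veronese sm d (line sm (l i))"
    "\<And>i. i < r \<Longrightarrow> v i = tscale (b i) (pow sm d (l i))"
    by metis
  have "f = (\<Sum>i<r. tscale (c i) (v i))"
    using dec unfolding waring_decomp_def by blast
  \<comment> \<open>The scalar relating \<open>v i\<close> to the power of \<open>l i\<close> is
    absorbed into the coefficient.\<close>
  also have "\<dots> = (\<Sum>i<r. tscale (c i * b i) (pow sm d (l i)))"
    by (intro sum.cong refl) (auto simp: l(3) fun_eq_iff)
  finally have f: "f = \<dots>" .
  have "line sm (l i) \<in> baseloc sm (A_ker sm d f E)" if "i < r" for i
    by (rule decomposition_points_in_baseloc[OF vs E f l(1) rank that])
  then show ?thesis
    using l(2) by auto
qed

section \<open>Decompositions and solutions of the linear system\<close>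

text \<open>Dropping the zero coefficients and renumbering the others leaves a decomposition whose
  length is the size of the multiset.\<close>

lemma solution_is_waring_decomp:
  assumes vs: "vector_space sm" and ls: "0 \<notin> set ls"
    and c: "c \<in> linear_system sm d f ls"
  obtains c' v where "waring_decomp sm d f (size (solution_decomp sm d ls c)) c' v"
    "solution_decomp sm d ls c =
      image_mset (\<lambda>i. tscale (c' i) (v i)) (mset_set {..<size (solution_decomp sm d ls c)})"
proof -
  define S where "S = {i. i < length ls \<and> c i \<noteq> 0}"
  let ?m = "size (solution_decomp sm d ls c)"
  have fin: "finite S" and m: "?m = card S"
    by (simp_all add: S_def solution_decomp_def)
  \<comment> \<open>An enumeration of the support of \<open>c\<close>, as decompositions are indexed
    by an initial segment.\<close>
  obtain h where h: "bij_betw h {..<?m} S"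
    using ex_bij_betw_nat_finite[OF fin] unfolding m atLeast0LessThan by blast
  let ?c = "\<lambda>i. c (h i)" and ?v = "\<lambda>i. pow sm d (ls ! h i)"
  have "f = (\<Sum>i<length ls. tscale (c i) (pow sm d (ls ! i)))"
    using c unfolding linear_system_def by blast
  also have "\<dots> = (\<Sum>i\<in>S. tscale (c i) (pow sm d (ls ! i)))"
    by (rule sum.mono_neutral_right) (auto simp: S_def fun_eq_iff)
  also have "\<dots> = (\<Sum>i<?m. tscale (?c i) (?v i))"
    by (rule sum.reindex_bij_betw[OF h, symmetric])
  finally have f: "f = \<dots>" .
  have "ls ! h i \<noteq> 0" if "i < ?m" for i
    using bij_betwE[OF h] ls that unfolding S_def by (metis (mono_tags, lifting) lessThan_iff mem_Collect_eq nth_mem)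
  then have "waring_decomp sm d f ?m ?c ?v"
    unfolding waring_decomp_def veronese_variety_def
    using f pow_in_sym_power[OF vs] pow_nonzero[OF vs] veronese_line[OF vs] line_in_proj_space
    by (metis (no_types, lifting) image_eqI)
  moreover have "solution_decomp sm d ls c = image_mset (\<lambda>i. tscale (?c i) (?v i)) (mset_set {..<?m})"
  proof -
    have "mset_set S = image_mset h (mset_set {..<?m})"
      using h by (simp add: image_mset_mset_set bij_betw_def)
    then show ?thesis
      unfolding solution_decomp_def S_def[symmetric] by (simp add: multiset.map_comp o_def)
  qed
  ultimately show thesis by (rule that)
qed

text \<open>This lower bound on the support of a solution is what rules out merging and cancellation
  in \<open>minimal_decomp_is_solution\<close>.\<close>

lemma waring_rank_le_solution:
  assumes "vector_space sm" "0 \<notin> set ls" "c \<in> linear_system sm d f ls"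
  shows "waring_rank sm d f \<le> size (solution_decomp sm d ls c)"
proof -
  obtain c' v where "waring_decomp sm d f (size (solution_decomp sm d ls c)) c' v"
    using solution_is_waring_decomp[OF assms] .
  then show ?thesis
    unfolding waring_rank_def by (intro Least_le) blast
qed

text \<open>Merging the terms of a minimal decomposition that lie over the same representative gives
  a solution of the linear system; by minimality nothing is actually merged or cancelled.\<close>

lemma minimal_decomp_is_solution:
  assumes vs: "vector_space sm" and ls: "representatives sm Z ls"
    and dec: "waring_decomp sm d f r c v" and r: "r = waring_rank sm d f"
    and Z: "(\<lambda>i. line tscale (v i)) ` {..<r} \<subseteq> veronese sm d ` Z"
  obtains c' where "c' \<in> linear_system sm d f ls"
    "solution_decomp sm d ls c' = image_mset (\<lambda>i. tscale (c i) (v i)) (mset_set {..<r})"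
proof -
  have ls0: "0 \<notin> set ls" using ls unfolding representatives_def by blast
  have "\<exists>j b. j < length ls \<and> v i = tscale b (pow sm d (ls ! j))" if "i < r" for i
  proof -
    have "line tscale (v i) \<in> veronese sm d ` Z"
      using Z that by blast
    then obtain x where "x \<in> Z" "line tscale (v i) = veronese sm d x"
      by blast
    moreover have "Z = line sm ` set ls"
      using ls unfolding representatives_def by simp
    ultimately obtain j where "j < length ls" "line tscale (v i) = veronese sm d (line sm (ls ! j))"
      by (auto simp: in_set_conv_nth)
    then show ?thesis
      using veronese_representative[OF vs] ls0 by (metis nth_mem)
  qed
  then obtain J b where J: "\<And>i. i < r \<Longrightarrow> J i < length ls"
    and v: "\<And>i. i < r \<Longrightarrow> v i = tscale (b i) (pow sm d (ls ! J i))"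
    by metis
  \<comment> \<open>The total coefficient of all terms over the \<open>j\<close>-th representative;
    for an index that \<open>J\<close> misses the sum is empty, hence 0.\<close>
  define c' where "c' j = (\<Sum>i | i < r \<and> J i = j. c i * b i)" for j
  define S where "S = {j. j < length ls \<and> c' j \<noteq> 0}"
  have term_eq: "tscale (c i) (v i) = tscale (c i * b i) (pow sm d (ls ! J i))" if "i < r" for i
    using v[OF that] by (simp add: fun_eq_iff)
  have outside: "c' j = 0" if "j \<notin> J ` {..<r}" for j
    unfolding c'_def by (rule sum.neutral) (use that in auto)
  have "f = (\<Sum>i<r. tscale (c i) (v i))"
    using dec unfolding waring_decomp_def by blast
  also have "\<dots> = (\<Sum>i<r. tscale (c i * b i) (pow sm d (ls ! J i)))"
    by (intro sum.cong refl) (simp add: term_eq)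
  also have "\<dots> = (\<Sum>j<length ls. \<Sum>i | i \<in> {..<r} \<and> J i = j. tscale (c i * b i) (pow sm d (ls ! J i)))"
    by (rule sum.group[symmetric]) (use J in auto)
  also have "\<dots> = (\<Sum>j<length ls. tscale (c' j) (pow sm d (ls ! j)))"
    by (intro sum.cong refl) (simp add: fun_eq_iff sum_apply c'_def sum_distrib_right)
  finally have f: "f = \<dots>" .
  have "j \<notin> J ` {..<r}" if "j \<ge> length ls" for j
    using J that by (auto simp: not_less[symmetric])
  then have sol: "c' \<in> linear_system sm d f ls"
    unfolding linear_system_def using f outside by blast
  have SJ: "S \<subseteq> J ` {..<r}"
    using outside unfolding S_def by auto
  have "r \<le> card S"
    \<comment> \<open>The support of \<open>c'\<close> lies in the image of \<open>J\<close>, which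
      has at most \<open>r\<close> elements, while minimality gives at least \<open>r\<close>.
      Equality throughout makes \<open>J\<close> injective and all merged coefficients
      nonzero.\<close>
    using waring_rank_le_solution[OF vs ls0 sol] r by (simp add: S_def solution_decomp_def)
  moreover have "card S \<le> card (J ` {..<r})" "card (J ` {..<r}) \<le> r"
    using SJ card_image_le[of "{..<r}" J] by (auto intro: card_mono)
  ultimately have "card S = card (J ` {..<r})" "card (J ` {..<r}) = card {..<r}"
    by simp_all
  then have S: "S = J ` {..<r}" and inj: "inj_on J {..<r}"
    using SJ by (simp_all add: card_subset_eq eq_card_imp_inj_on)
  have "c' (J i) = c i * b i" if "i < r" for i
  proof -
    have "{k. k < r \<and> J k = J i} = {i}"
      using inj that by (auto simp: inj_on_def)
    then show ?thesis by (simp add: c'_def)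
  qed
  then have "image_mset (\<lambda>i. tscale (c' (J i)) (pow sm d (ls ! J i))) (mset_set {..<r})
      = image_mset (\<lambda>i. tscale (c i) (v i)) (mset_set {..<r})"
    by (intro image_mset_cong) (simp add: term_eq)
  moreover have "solution_decomp sm d ls c'
      = image_mset (\<lambda>i. tscale (c' (J i)) (pow sm d (ls ! J i))) (mset_set {..<r})"
    unfolding solution_decomp_def S_def[symmetric] S image_mset_mset_set[OF inj, symmetric]
    by (simp add: multiset.map_comp o_def)
  ultimately show thesis
    using that[OF sol] by simp
qed

text \<open>For independent \<open>u\<close> and \<open>w\<close> the points [u + a w] are pairwise
  distinct. This excludes a trivial kernel in the algorithm, since its base locus would be all of
  projective space.\<close>

lemma infinite_proj_space:
  assumes vs: "vector_space sm" and dim: "vector_space.dim sm (UNIV :: 'v::ab_group_add set) \<ge> 2"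
  shows "infinite (proj_space sm (UNIV :: 'v set))"
proof -
  interpret V: vector_space sm by fact
  obtain B where B: "V.independent B" "card B = V.dim (UNIV :: 'v set)"
    by (rule V.basis_exists[of UNIV])
  have "finite B"
    using B(2) dim by (intro card_ge_0_finite) simp
  then obtain u w where uw: "u \<in> B" "w \<in> B" "u \<noteq> w"
    using card_le_Suc0_iff_eq[of B] B(2) dim by auto
  obtain \<xi> where \<xi>: "Vector_Spaces.linear sm (*) \<xi>"
    "\<forall>b\<in>B. \<xi> b = (if b = u then 1 else 0 :: complex)"
    by (rule exists_linear_form[OF vs B(1), of "\<lambda>b. if b = u then 1 else 0"])
  obtain \<eta> where \<eta>: "Vector_Spaces.linear sm (*) \<eta>"
    "\<forall>b\<in>B. \<eta> b = (if b = w then 1 else 0 :: complex)"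
    by (rule exists_linear_form[OF vs B(1), of "\<lambda>b. if b = w then 1 else 0"])
  let ?p = "\<lambda>a. u + sm a w"
  have val: "\<xi> (?p a) = 1" "\<eta> (?p a) = a" for a
    using uw by (simp_all add: linear_add[OF \<xi>(1)] linear_mult[OF \<xi>(1)] linear_add[OF \<eta>(1)]
        linear_mult[OF \<eta>(1)] \<xi>(2) \<eta>(2))
  have "inj (\<lambda>a. line sm (?p a))"
  proof (rule injI)
    fix a a' assume "line sm (?p a) = line sm (?p a')"
    then obtain k where "?p a = sm k (?p a')"
      using self_in_line[OF vs] mem_line[OF vs] by metis
    \<comment> \<open>Comparing the values of \<xi>, both 1, gives \<open>k = 1\<close>; then \<eta>
      gives \<open>a = a'\<close>.\<close>
    then have "\<xi> (?p a) = k * \<xi> (?p a')" "\<eta> (?p a) = k * \<eta> (?p a')"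
      using linear_mult[OF \<xi>(1)] linear_mult[OF \<eta>(1)] by simp_all
    then show "a = a'"
      unfolding val by simp
  qed
  moreover have "?p a \<noteq> 0" for a
    using val(1)[of a] linear_zero[OF \<xi>(1)] by force
  then have "range (\<lambda>a. line sm (?p a)) \<subseteq> proj_space sm UNIV"
    using line_in_proj_space by blast
  ultimately show ?thesis
    using infinite_UNIV_char_0 by (meson finite_imageD finite_subset)
qed

theorem theorem4p7:
  fixes sm :: "complex \<Rightarrow> 'v \<Rightarrow> 'v::ab_group_add"
    and n d :: nat
    and f :: "'v sym_tensor"
    and E :: "('v, 'w::ab_group_add, 'e::finite) vbundle"
    and Z' :: "'v set set"
  assumes "vector_space sm"
    and "vector_space.dim sm (UNIV :: 'v set) = n + 1"
    and "f \<in> sym_power sm d"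
    and "vector_bundle sm E"
    and "Z' = baseloc sm (A_ker sm d f E)"
    and "real (waring_rank sm d f) = real (A_rank sm d f E) / real (bundle_rank E)"
  shows "(\<forall>c v. waring_decomp sm d f (waring_rank sm d f) c v \<longrightarrow>
           (\<lambda>i. line tscale (v i)) ` {..<waring_rank sm d f} \<subseteq> veronese sm d ` Z')
       \<and> (baseloc_length sm E (A_ker sm d f E) < \<infinity> \<longrightarrow>
           (\<forall>ls. representatives sm Z' ls \<longrightarrow>
              minimal_waring_decomps sm d f =
                {M \<in> solution_decomp sm d ls ` linear_system sm d f ls. size M = waring_rank sm d f}
            \<and> (\<forall>c. linear_system sm d f ls = {c} \<longrightarrow>
                 minimal_waring_decomps sm d f = {solution_decomp sm d ls c})
            \<and> (n \<ge> 1 \<and> finite_reduced sm E (A_ker sm d f E) \<longrightarrow>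
                 gtd_algorithm sm d f E ls =
                   Some (solution_decomp sm d ls ` linear_system sm d f ls))))"
proof (intro conjI impI allI)
  let ?r = "waring_rank sm d f"
  let ?K = "A_ker sm d f E"
  \<comment> \<open>The rank of the bundle is the cardinality of a finite type, hence positive, so
    the division can be cleared.\<close>
  have rank: "A_rank sm d f E = ?r * CARD('e)"
    using assms(6) by (simp add: bundle_rank_def field_simps flip: of_nat_mult)
  have in_baseloc: "(\<lambda>i. line tscale (v i)) ` {..<?r} \<subseteq> veronese sm d ` Z'"
    if "waring_decomp sm d f ?r c v" for c v
    using waring_decomp_points_in_baseloc[OF assms(1,4) that rank] assms(5) by simp
  then show "(\<lambda>i. line tscale (v i)) ` {..<?r} \<subseteq> veronese sm d ` Z'"
    if "waring_decomp sm d f ?r c v" for c v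
    using that .
  fix ls assume ls: "representatives sm Z' ls"
  then have ls0: "0 \<notin> set ls" and fin: "finite Z'"
    unfolding representatives_def by auto
  show min: "minimal_waring_decomps sm d f =
      {M \<in> solution_decomp sm d ls ` linear_system sm d f ls. size M = ?r}" (is "_ = ?R")
  proof (intro equalityI subsetI)
    fix M assume "M \<in> minimal_waring_decomps sm d f"
    then obtain c v where M: "M = image_mset (\<lambda>i. tscale (c i) (v i)) (mset_set {..<?r})"
      and dec: "waring_decomp sm d f ?r c v"
      unfolding minimal_waring_decomps_def by blast
    obtain c' where "c' \<in> linear_system sm d f ls" "solution_decomp sm d ls c' = M"
      using minimal_decomp_is_solution[OF assms(1) ls dec refl in_baseloc[OF dec]] M by metis
    moreover have "size M = ?r" using M by simp
    ultimately show "M \<in> ?R" by blast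
  next
    fix M assume "M \<in> ?R"
    then obtain c where c: "c \<in> linear_system sm d f ls" "M = solution_decomp sm d ls c" "size M = ?r"
      by blast
    then show "M \<in> minimal_waring_decomps sm d f"
      using solution_is_waring_decomp[OF assms(1) ls0 c(1)]
      unfolding minimal_waring_decomps_def mem_Collect_eq by metis
  qed
  show "minimal_waring_decomps sm d f = {solution_decomp sm d ls c}"
    if c: "linear_system sm d f ls = {c}" for c
  proof -
    have "c \<in> linear_system sm d f ls" using c by simp
    then have "\<exists>m c v. waring_decomp sm d f m c v"
      using solution_is_waring_decomp[OF assms(1) ls0] by metis
    then have "\<exists>c v. waring_decomp sm d f ?r c v"
      \<comment> \<open>A solution makes the set of lengths nonempty, so the least length is
        attained. The minimal decompositions then form a nonempty subset of a singleton.\<close>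
      unfolding waring_rank_def by (rule LeastI_ex)
    then have "minimal_waring_decomps sm d f \<noteq> {}"
      unfolding minimal_waring_decomps_def by blast
    then show ?thesis
      using c unfolding min by auto
  qed
  assume n: "n \<ge> 1 \<and> finite_reduced sm E ?K"
  have "?K \<noteq> {0}"
  proof
    assume "?K = {0}"
    \<comment> \<open>The zero section vanishes everywhere, so the base locus would be infinite when
      n is at least 1, yet \<open>Z'\<close> is listed by \<open>ls\<close>.\<close>
    then have "Z' = proj_space sm UNIV"
      using assms(5) by (simp add: baseloc_def)
    then show False
      using infinite_proj_space[OF assms(1)] fin n assms(2) by simp
  qed
  then show "gtd_algorithm sm d f E ls = Some (solution_decomp sm d ls ` linear_system sm d f ls)"
    using n by (simp add: gtd_algorithm_def Let_def)
qed

end
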